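(* Let $t\geq 2$ be an integer, $m=4t+2$, $n=2^m+1$, $a=2^{2t+2}+2^{2t+1}$, and let $\delta_1=\frac{n}{5}$, $\delta_2=2^{4t-1}+\frac{2^{4t}-1}{5}$, $\delta_3=\delta_2-6$, with $\delta_4=\delta_2-8$, $\delta_5=\delta_2-24$ if $t=2$ and $\delta_4=\delta_2-96$, $\delta_5=\delta_2-102$ if $t>2$. Let $\delta$ be an odd integer. Then: (1) $\mathcal{C}(n,2,\delta,1)$ has parameters $[n,\ n-m\delta+3m,\ d\geq\delta]$ if $2^{2t+1}+3\leq\delta\leq 2^{2t+2}-5$; $[n,\ n-m\delta+11m,\ d\geq\delta]$ if $2^{2t+2}+5\leq\delta\leq 2^{2t+2}+2^{2t}-3$; $[n,\ n-m\delta+15m,\ d\geq\delta]$ if $2^{2t+2}+2^{2t}+3\leq\delta\leq a-3$; $[n,\ n-ma+16m,\ d\geq a+5]$ if $a-1\leq\delta\leq a+5$; $[n,\ 2m(i-1)+5,\ d\geq\delta_i]$ if $\delta_{i+1}+2\leq\delta\leq\delta_i$ for some $i\in\{1,2,3,4\}$; $[n,1,n]$ if $\delta_1+2\leq\delta\leq n$. (2) $\mathcal{C}(n,2,\delta+1,0)$ has parameters $[n,\ 2^m-m\delta+3m,\ d\geq2\delta]$ if $2^{2t+1}+3\leq\delta\leq 2^{2t+2}-5$; $[n,\ 2^m-m\delta+11m,\ d\geq2\delta]$ if $2^{2t+2}+5\leq\delta\leq 2^{2t+2}+2^{2t}-3$; $[n,\ 2^m-m\delta+15m,\ d\geq2\delta]$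 if $2^{2t+2}+2^{2t}+3\leq\delta\leq a-3$; $[n,\ 2^m-ma+16m,\ d\geq2(a+5)]$ if $a-1\leq\delta\leq a+5$; $[n,\ 2m(i-1)+4,\ d\geq2\delta_i]$ if $\delta_{i+1}+2\leq\delta\leq\delta_i$ for some $i\in\{1,2,3,4\}$.
   Context: For $n=2^m+1$ and an integer $x$, the 2-cyclotomic coset of $x$ modulo $n$ is $C_x=\{x\cdot 2^{j} \bmod n : j\geq 0\}\subseteq\{0,1,\dots,n-1\}$. Let $\xi$ be a primitive $n$-th root of unity in an extension field of $\mathbb{F}_2$. A binary cyclic code of length $n$ with generator polynomial $g(x)$ has defining set $\{i\in\{0,\dots,n-1\}: g(\xi^i)=0\}$ (a union of cosets $C_x$), and its dimension is $n$ minus the size of the defining set. $\mathcal{C}(n,2,\delta,1)$ denotes the binary cyclic code of length $n$ with defining set $C_1\cup C_2\cup\cdots\cup C_{\delta-1}$, and $\mathcal{C}(n,2,\delta+1,0)$ the one with defining set $C_0\cup C_1\cup\cdots\cup C_{\delta-1}$. $[n,k,d]$ denotes a linear code of length $n$, dimension $k$, minimum Hamming distance $d$. *)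

theory Defs
  imports Main
begin

definition cyc_coset :: "nat \<Rightarrow> nat \<Rightarrow> nat set" where
  "cyc_coset n x = {x * 2 ^ j mod n | j. True}"

text \<open>Binary words of length n are represented by their supports S \<subseteq> {0..<n}.
  The binary cyclic code of length n with defining set D (w.r.t. the n-th root of
  unity xi in a field of characteristic 2) consists of the words c with c(xi^j) = 0
  for all j in D, i.e. sum_{i in S} xi^(i*j) = 0.\<close>
definition bin_cyclic_code :: "'f::field \<Rightarrow> nat \<Rightarrow> nat set \<Rightarrow> nat set set" where
  "bin_cyclic_code \<xi> n D = {S. S \<subseteq> {..<n} \<and> (\<forall>j\<in>D. (\<Sum>i\<in>S. \<xi> ^ (i * j)) = 0)}"

definition bch_code :: "'f::field \<Rightarrow> nat \<Rightarrow> nat \<Rightarrow> nat \<Rightarrow> nat set set" where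
  "bch_code \<xi> n \<delta> b = bin_cyclic_code \<xi> n (\<Union>x\<in>{b..<b + \<delta> - 1}. cyc_coset n x)"

text \<open>Minimum Hamming distance = minimum weight of a nonzero codeword (linear code).\<close>
definition min_dist :: "nat set set \<Rightarrow> nat" where
  "min_dist C = Inf (card ` (C - {{}}))"

text \<open>Dimension over GF(2): the code is a GF(2)-subspace, so it has 2^k elements.\<close>
definition code_params :: "nat set set \<Rightarrow> nat \<Rightarrow> nat \<Rightarrow> bool" where
  "code_params C k d \<longleftrightarrow> card C = 2 ^ k \<and> d \<le> min_dist C"

end

theory Submission
  imports Defs "HOL-Computational_Algebra.Polynomial" "HOL-Number_Theory.Cong"
begin

text \<open>
  A cyclic code with defining set $D$ has dimension $n - |D|$, because its generator polynomial
  $\prod_{j \in D}(x - \xi^j)$ is fixed by the Frobenius map; since $2^m \equiv -1$ modulo $n$, all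
  cosets are closed under negation, which doubles the BCH bound as soon as $0 \in D$. It remains
  to count cosets through their leaders, i.e. the least absolute values in an orbit of doubling
  modulo $n$.

  For leaders up to $3\sqrt n$, a coincidence $2^k x \equiv \pm y$ can be read in the direction
  with $2^k \le \sqrt n$, and then leaves ten odd non-leaders. For the largest leaders, put
  $N = n/5$. Near $N$, multiplication by 16 acts on $N - e$ by $e \mapsto 16e$ or
  $e \mapsto 2N - 16e$ (up to sign). As $m \equiv 2$ modulo 4, an orbit other than that of $N$
  cannot keep $0 \le e \le N/8$; so its leader is at most $\delta_2 = (7N-3)/8$, and the orbits of
  $\delta_2 - j$ for small $j$ are followed explicitly.
\<close>

section \<open>Binary cyclic codes\<close>

text \<open>Even numbers are never leaders, and every coset counted through its leader has 2m
  elements, except that of n/5. So if c odd numbers below an odd delta are not leaders, the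
  dimension for b = 1 is n - 2m((delta - 1)/2 - c) = n - m delta + (2c + 1)m; the factors 3, 11 and
  15 belong to c = 1, 5 and 7. Between a - 1 and a + 5 every odd number that is passed is a
  non-leader, so the code stays the same and delta drops out of the formula. For large delta the
  cosets outside the defining set are counted instead. The coset of n/5 has only four elements,
  because n/5 times a power of 2 depends on that power modulo 5; with the residue 0 this gives the
  constant 5, and each further leader adds 2m. A coincidence 2^k x = y modulo n also says 2^(m-k) y
  = -x. With r = 2^(2t) the modulus is 4r^2 + 1, so one of the two readings has a multiplier of at
  most 2r.\<close>

lemma bch_bound:
  fixes \<xi> :: "'f::field"
  assumes inj: "inj_on (\<lambda>i. \<xi> ^ i) S" and fin: "finite S" and ne: "S \<noteq> {}" and nz: "\<xi> \<noteq> 0"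
    and zero: "\<And>j. b \<le> j \<Longrightarrow> j < b + d - 1 \<Longrightarrow> (\<Sum>i\<in>S. \<xi> ^ (i * j)) = 0"
  shows "d \<le> card S"
proof (rule ccontr)
  assume "\<not> d \<le> card S"
  then have less: "card S < d" by simp
  from ne obtain i0 where i0: "i0 \<in> S" by blast
  \<comment> \<open>\<open>q\<close> vanishes at all locators of the word except that of
    \<open>i0\<close>, and its degree is at most d - 2. Weighting the word with \<open>q\<close>
    therefore uses only the d - 1 given checks, yet leaves a single nonzero term. This takes the
    place of a Vandermonde determinant.\<close>
  define q where "q = (\<Prod>i\<in>S - {i0}. [:- (\<xi> ^ i), 1:])"
  have deg: "degree q = card S - 1"
    unfolding q_def by (subst degree_prod_eq_sum_degree) (use i0 in auto)
  have q0: "poly q (\<xi> ^ i) = 0" if "i \<in> S - {i0}" for i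
    unfolding q_def poly_prod using that fin by (intro prod_zero) auto
  have qn: "poly q (\<xi> ^ i0) \<noteq> 0"
    unfolding q_def poly_prod using fin i0 inj by (auto simp: inj_on_def)
  have "(\<Sum>i\<in>S. \<xi> ^ (i * b) * poly q (\<xi> ^ i))
      = (\<Sum>i\<in>S. \<Sum>k\<le>degree q. coeff q k * \<xi> ^ (i * (b + k)))"
    by (simp add: poly_altdef sum_distrib_left power_add power_mult algebra_simps)
  also have "\<dots> = (\<Sum>k\<le>degree q. coeff q k * (\<Sum>i\<in>S. \<xi> ^ (i * (b + k))))"
    by (subst sum.swap) (simp add: sum_distrib_left)
  also have "\<dots> = 0"
  proof (intro sum.neutral ballI)
    fix k assume "k \<in> {..degree q}"
    moreover have "card S > 0" using fin ne by (simp add: card_gt_0_iff)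
    ultimately have "b + k < b + d - 1" using deg less by auto
    then show "coeff q k * (\<Sum>i\<in>S. \<xi> ^ (i * (b + k))) = 0" by (simp add: zero)
  qed
  finally have "(\<Sum>i\<in>S. \<xi> ^ (i * b) * poly q (\<xi> ^ i)) = 0" .
  moreover have "(\<Sum>i\<in>S. \<xi> ^ (i * b) * poly q (\<xi> ^ i)) = \<xi> ^ (i0 * b) * poly q (\<xi> ^ i0)"
    using fin i0 q0 by (subst sum.remove[of _ i0]) auto
  ultimately show False using qn nz by simp
qed

section \<open>Codewords as multiples of the generator polynomial\<close>

lemma prod_linear_dvd_iff:
  fixes p :: "'f::field poly"
  assumes "finite A"
  shows "(\<Prod>a\<in>A. [:- a, 1:]) dvd p \<longleftrightarrow> (\<forall>a\<in>A. poly p a = 0)"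
  using assms
proof (induction A arbitrary: p rule: finite_induct)
  case (insert a A)
  have na: "poly (\<Prod>a\<in>A. [:- a, 1:]) a \<noteq> 0"
    using insert.hyps by (auto simp: poly_prod)
  show ?case
  proof
    assume "(\<Prod>a\<in>insert a A. [:- a, 1:]) dvd p"
    then have d: "[:- a, 1:] * (\<Prod>a\<in>A. [:- a, 1:]) dvd p" using insert.hyps by simp
    have "poly p a = 0" using dvd_mult_left[OF d] by (simp add: poly_eq_0_iff_dvd)
    moreover have "\<forall>a\<in>A. poly p a = 0" using dvd_mult_right[OF d] insert.IH by blast
    ultimately show "\<forall>a\<in>insert a A. poly p a = 0" by simp
  next
    assume roots: "\<forall>a\<in>insert a A. poly p a = 0"
    then have "(\<Prod>a\<in>A. [:- a, 1:]) dvd p" using insert.IH by blast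
    then obtain h where h: "p = (\<Prod>a\<in>A. [:- a, 1:]) * h" by (elim dvdE)
    have "poly h a = 0" using roots na unfolding h by simp
    then have "[:- a, 1:] dvd h" by (simp add: poly_eq_0_iff_dvd)
    then have "[:- a, 1:] * (\<Prod>a\<in>A. [:- a, 1:]) dvd p"
      unfolding h by (subst mult.commute) (rule mult_dvd_mono[OF dvd_refl])
    then show "(\<Prod>a\<in>insert a A. [:- a, 1:]) dvd p" using insert.hyps by simp
  qed
qed simp

text \<open>In characteristic 2 this is a ring homomorphism whose fixed points are the polynomials
  over GF(2). Working with fixed points keeps everything inside one polynomial ring and avoids
  constructing the prime field as a type.\<close>

definition frob_poly :: "'f::field poly \<Rightarrow> 'f poly" where
  "frob_poly p = map_poly (\<lambda>x. x\<^sup>2) p"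

lemma coeff_frob_poly [simp]: "coeff (frob_poly p) i = (coeff p i)\<^sup>2"
  by (simp add: frob_poly_def coeff_map_poly)

lemma char2_double:
  assumes "CHAR('f::field) = 2"
  shows "x + x = (0::'f)"
proof -
  have "(of_nat CHAR('f) :: 'f) = 0" by (rule of_nat_CHAR)
  then have "(2::'f) = 0" unfolding assms by simp
  then show ?thesis by (metis mult_2 mult_zero_left)
qed

lemma char2_square_sum:
  fixes f :: "'a \<Rightarrow> 'f::field"
  assumes "CHAR('f) = 2"
  shows "(\<Sum>i\<in>A. f i)\<^sup>2 = (\<Sum>i\<in>A. (f i)\<^sup>2)"
proof (induction A rule: infinite_finite_induct)
  case (insert x F)
  have "(f x + sum f F)\<^sup>2 = (f x)\<^sup>2 + (sum f F)\<^sup>2 + (f x * sum f F + f x * sum f F)"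
    by (simp add: power2_eq_square algebra_simps)
  then show ?case using insert char2_double[OF assms] by simp
qed auto

lemma frob_poly_mult:
  fixes p q :: "'f::field poly"
  assumes "CHAR('f) = 2"
  shows "frob_poly (p * q) = frob_poly p * frob_poly q"
  by (rule poly_eqI) (simp add: coeff_mult char2_square_sum[OF assms] power_mult_distrib)

lemma frob_poly_prod:
  fixes f :: "'a \<Rightarrow> 'f::field poly"
  assumes "CHAR('f) = 2"
  shows "frob_poly (\<Prod>i\<in>A. f i) = (\<Prod>i\<in>A. frob_poly (f i))"
proof -
  have "frob_poly (1 :: 'f poly) = 1" by (rule poly_eqI) (simp add: coeff_1)
  then show ?thesis
    by (induction A rule: infinite_finite_induct) (auto simp: frob_poly_mult[OF assms])
qed

lemma frob_poly_fixed_iff: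
  fixes p :: "'f::field poly"
  shows "frob_poly p = p \<longleftrightarrow> (\<forall>i. coeff p i \<in> {0, 1})"
proof -
  have "(x\<^sup>2 = x) = (x \<in> {0, 1})" for x :: 'f by (auto simp: power2_eq_square)
  then show ?thesis by (simp add: poly_eq_iff)
qed

definition word_poly :: "nat set \<Rightarrow> 'f::field poly" where
  "word_poly S = (\<Sum>i\<in>S. monom 1 i)"

lemma coeff_word_poly: "finite S \<Longrightarrow> coeff (word_poly S) i = (if i \<in> S then 1 else 0)"
  by (simp add: word_poly_def coeff_sum)

lemma poly_word_poly: "poly (word_poly S) x = (\<Sum>i\<in>S. x ^ i)"
  by (simp add: word_poly_def poly_sum poly_monom)

text \<open>The degree bound is stated through coefficients so that the zero polynomial and the case
  r = 0 are covered uniformly.\<close>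

definition bin_polys :: "nat \<Rightarrow> 'f::field poly set" where
  "bin_polys r = {p. frob_poly p = p \<and> (\<forall>i\<ge>r. coeff p i = 0)}"

lemma bij_betw_word_poly: "bij_betw word_poly (Pow {..<r}) (bin_polys r :: 'f::field poly set)"
proof -
  have inj: "inj_on (word_poly :: nat set \<Rightarrow> 'f poly) (Pow {..<r})"
  proof (rule inj_onI)
    fix A B :: "nat set"
    assume "A \<in> Pow {..<r}" "B \<in> Pow {..<r}" and eq: "(word_poly A :: 'f poly) = word_poly B"
    then have "finite A" "finite B" using finite_subset by auto
    then have "(i \<in> A) = (i \<in> B)" for i
      using arg_cong[OF eq, of "\<lambda>p. coeff p i"] by (simp add: coeff_word_poly split: if_splits)
    then show "A = B" by blast
  qed
  have "word_poly ` Pow {..<r} = (bin_polys r :: 'f poly set)"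
  proof (intro equalityI subsetI)
    fix p :: "'f poly" assume "p \<in> word_poly ` Pow {..<r}"
    then obtain S where S: "S \<subseteq> {..<r}" and p: "p = word_poly S" by auto
    have "finite S" using S finite_subset by auto
    then show "p \<in> bin_polys r"
      using S by (auto simp: bin_polys_def frob_poly_fixed_iff p coeff_word_poly)
  next
    fix p :: "'f poly" assume p: "p \<in> bin_polys r"
    define S where "S = {i. coeff p i = 1}"
    have S: "S \<subseteq> {..<r}"
      using p by (auto simp: bin_polys_def S_def) (metis not_less zero_neq_one)
    then have "finite S" using finite_subset by auto
    then have "p = word_poly S"
      using p by (intro poly_eqI) (auto simp: coeff_word_poly bin_polys_def frob_poly_fixed_iff S_def)
    then show "p \<in> word_poly ` Pow {..<r}" using S by blast
  qed
  then show ?thesis using inj by (simp add: bij_betw_def)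
qed

lemma inj_on_double_mod:
  assumes "odd n"
  shows "inj_on (\<lambda>j. 2 * j mod n) {..<n::nat}"
proof (rule inj_onI)
  fix i j assume ij: "i \<in> {..<n}" "j \<in> {..<n}" "2 * i mod n = 2 * j mod n"
  then have "[2 * i = 2 * j] (mod n)" by (simp add: cong_def)
  then have "[i = j] (mod n)" using assms by (simp add: cong_mult_lcancel_nat)
  then show "i = j" using ij by (simp add: cong_def)
qed

text \<open>Multiplication by \<open>g\<close> is a bijection from the binary polynomials of degree
  below n - |D| onto the codewords, so the size follows without linear algebra over GF(2).\<close>

lemma card_bin_cyclic_code:
  fixes \<xi> :: "'f::field"
  assumes ch: "CHAR('f) = 2" and n: "odd n" and D: "D \<subseteq> {..<n}"
    and dbl: "\<And>j. j \<in> D \<Longrightarrow> 2 * j mod n \<in> D"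
    and one: "\<xi> ^ n = 1" and inj: "inj_on (\<lambda>i. \<xi> ^ i) {..<n}"
  shows "card (bin_cyclic_code \<xi> n D) = 2 ^ (n - card D)"
proof -
  have finD: "finite D" using D finite_subset by auto
  have injD: "inj_on (\<lambda>i. \<xi> ^ i) D" using inj D inj_on_subset by blast
  define g where "g = (\<Prod>j\<in>D. [:- (\<xi> ^ j), 1:])"
  have g': "g = (\<Prod>a\<in>(\<lambda>j. \<xi> ^ j) ` D. [:- a, 1:])"
    unfolding g_def by (simp add: prod.reindex[OF injD] o_def)
  have gdvd: "g dvd p \<longleftrightarrow> (\<forall>j\<in>D. poly p (\<xi> ^ j) = 0)" for p
    unfolding g' using finD by (subst prod_linear_dvd_iff) auto
  have deg: "degree g = card D"
    unfolding g_def by (subst degree_prod_eq_sum_degree) auto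
  have g0: "g \<noteq> 0" unfolding g_def using finD by (simp add: prod_zero_iff)
  have neg: "- x = x" for x :: 'f using char2_double[OF ch, of x] by (simp add: neg_eq_iff_add_eq_0)
  have frob_lin: "frob_poly [:- (\<xi> ^ j), 1:] = [:- (\<xi> ^ (2 * j mod n)), 1:]" for j
  proof -
    have "\<xi> ^ (2 * j mod n) = \<xi> ^ (2 * j mod n) * (\<xi> ^ n) ^ (2 * j div n)" using one by simp
    also have "\<dots> = \<xi> ^ (2 * j)" by (simp flip: power_mult power_add)
    finally have *: "\<xi> ^ (2 * j mod n) = (\<xi> ^ j)\<^sup>2" by (simp add: mult.commute flip: power_mult)
    show ?thesis unfolding *
      by (rule poly_eqI) (simp add: coeff_pCons neg split: nat.split)
  qed
  have inj2: "inj_on (\<lambda>j. 2 * j mod n) D" using inj_on_double_mod[OF n] D inj_on_subset by blast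
  have img: "(\<lambda>j. 2 * j mod n) ` D = D"
    using finD inj2 dbl by (intro endo_inj_surj) auto
  have gfix: "frob_poly g = g"
  proof -
    have "frob_poly g = (\<Prod>j\<in>D. [:- (\<xi> ^ (2 * j mod n)), 1:])"
      unfolding g_def by (simp only: frob_poly_prod[OF ch] frob_lin)
    also have "\<dots> = (\<Prod>j\<in>(\<lambda>j. 2 * j mod n) ` D. [:- (\<xi> ^ j), 1:])"
      by (simp add: prod.reindex[OF inj2] o_def)
    finally show ?thesis unfolding img g_def .
  qed
  have code: "bin_cyclic_code \<xi> n D = {S \<in> Pow {..<n}. g dvd word_poly S}"
    by (auto simp: bin_cyclic_code_def gdvd poly_word_poly mult.commute simp flip: power_mult)
  have "card (bin_cyclic_code \<xi> n D) = card (word_poly ` bin_cyclic_code \<xi> n D :: 'f poly set)"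
    using bij_betw_word_poly[of n, where 'f = 'f] unfolding code bij_betw_def
    by (intro card_image[symmetric]) (auto elim: inj_on_subset)
  also have "word_poly ` bin_cyclic_code \<xi> n D = {p \<in> bin_polys n. g dvd p}"
    using bij_betw_imp_surj_on[OF bij_betw_word_poly[of n, where 'f = 'f]] unfolding code
    by (auto simp: image_iff)
  also have "\<dots> = (*) g ` bin_polys (n - card D)"
  proof (intro equalityI subsetI)
    fix p assume "p \<in> {p \<in> bin_polys n. g dvd p}"
    then obtain h where p: "p \<in> bin_polys n" and h: "p = g * h" by (auto elim: dvdE)
    \<comment> \<open>Divisibility only yields a quotient \<open>h\<close> over the large field.
      Since \<open>p\<close> and \<open>g\<close> are both fixed, cancelling \<open>g\<close> shows
      that \<open>h\<close> is fixed too, hence binary.\<close>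
    have "g * frob_poly h = g * h"
      using p gfix frob_poly_mult[OF ch, of g h] unfolding h bin_polys_def by simp
    then have hfix: "frob_poly h = h" using g0 by simp
    have "coeff h i = 0" if "i \<ge> n - card D" for i
    proof (cases "h = 0")
      case False
      have "degree p = card D + degree h"
        unfolding h using degree_mult_eq[OF g0 False] deg by simp
      moreover have "degree p < n"
      proof (rule ccontr)
        assume "\<not> degree p < n"
        then have "coeff p (degree p) = 0" using p by (simp add: bin_polys_def)
        then show False using False g0 h by simp
      qed
      ultimately show ?thesis using that by (intro coeff_eq_0) simp
    qed simp
    then show "p \<in> (*) g ` bin_polys (n - card D)" using hfix h by (auto simp: bin_polys_def)
  next
    fix p assume "p \<in> (*) g ` bin_polys (n - card D)"
    then obtain h where h: "h \<in> bin_polys (n - card D)" and p: "p = g * h" by auto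
    have "frob_poly p = p" using h gfix frob_poly_mult[OF ch, of g h] by (simp add: p bin_polys_def)
    moreover have "coeff p i = 0" if "i \<ge> n" for i
    proof (cases "h = 0")
      case False
      have "degree h < n - card D"
      proof (rule ccontr)
        assume "\<not> degree h < n - card D"
        then have "coeff h (degree h) = 0" using h by (simp add: bin_polys_def)
        then show False using False by simp
      qed
      then show ?thesis
        unfolding p using degree_mult_eq[OF g0 False] deg that by (intro coeff_eq_0) simp
    qed (simp add: p)
    ultimately show "p \<in> {p \<in> bin_polys n. g dvd p}" using p by (simp add: bin_polys_def)
  qed
  also have "card \<dots> = card (bin_polys (n - card D) :: 'f poly set)"
    using g0 by (intro card_image) (auto simp: inj_on_def)
  also have "\<dots> = 2 ^ (n - card D)"
    using bij_betw_same_card[OF bij_betw_word_poly[of "n - card D", where 'f = 'f]]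
    by (simp add: card_Pow)
  finally show ?thesis .
qed

section \<open>Cyclotomic cosets modulo $2^m+1$ and their leaders\<close>

text \<open>Orbits of doubling, on integers instead of residues: since 2^m = -1, orbits are
  symmetric about 0, and signed representatives make their small members visible as small absolute
  values.\<close>

definition eqv :: "nat \<Rightarrow> int \<Rightarrow> int \<Rightarrow> bool" where
  "eqv m x y \<longleftrightarrow> (\<exists>k. [2 ^ k * x = y] (mod (2 ^ m + 1)))"

lemma pow2_m_cong: "[2 ^ m * x = - x] (mod (2 ^ m + 1 :: int))"
  by (simp add: cong_iff_dvd_diff algebra_simps) (metis dvd_triv_left distrib_left mult.commute mult.right_neutral)

lemma pow2_mult_m_cong: "[2 ^ (m * a) * x = (-1) ^ a * x] (mod (2 ^ m + 1 :: int))"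
proof (induction a)
  case (Suc a)
  have "[2 ^ m * (2 ^ (m * a) * x) = 2 ^ m * ((-1) ^ a * x)] (mod (2 ^ m + 1 :: int))"
    by (intro cong_mult cong_refl Suc)
  also have "[2 ^ m * ((-1) ^ a * x) = - ((-1) ^ a * x)] (mod (2 ^ m + 1 :: int))"
    by (rule pow2_m_cong)
  finally show ?case by (simp add: power_add mult.assoc)
qed simp

lemma eqv_refl: "eqv m x x"
  unfolding eqv_def by (rule exI[of _ 0]) simp

lemma eqv_minus: "eqv m x (- x)"
  unfolding eqv_def using pow2_m_cong by blast

lemma eqv_trans:
  assumes "eqv m x y" "eqv m y z"
  shows "eqv m x z"
proof -
  from assms obtain k l where k: "[2 ^ k * x = y] (mod (2 ^ m + 1))"
    and l: "[2 ^ l * y = z] (mod (2 ^ m + 1))" unfolding eqv_def by blast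
  have "[2 ^ l * (2 ^ k * x) = 2 ^ l * y] (mod (2 ^ m + 1))" by (intro cong_mult cong_refl k)
  from cong_trans[OF this l] have "[2 ^ (l + k) * x = z] (mod (2 ^ m + 1))"
    by (simp add: power_add mult.assoc)
  then show ?thesis unfolding eqv_def by blast
qed

lemma eqv_sym:
  assumes "m > 0" "eqv m x y"
  shows "eqv m y x"
proof -
  from assms obtain k where k: "[2 ^ k * x = y] (mod (2 ^ m + 1))" unfolding eqv_def by blast
  \<comment> \<open>2^(2mk) is 1 modulo n, so 2mk - k further doublings undo the first k.\<close>
  have e: "2 * m * k - k + k = m * (2 * k)" using assms(1) by (cases m) auto
  have "[2 ^ (2 * m * k - k) * (2 ^ k * x) = 2 ^ (2 * m * k - k) * y] (mod (2 ^ m + 1))"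
    by (intro cong_mult cong_refl k)
  then have "[2 ^ (m * (2 * k)) * x = 2 ^ (2 * m * k - k) * y] (mod (2 ^ m + 1))"
    by (simp add: e flip: power_add mult.assoc)
  moreover have "[2 ^ (m * (2 * k)) * x = x] (mod (2 ^ m + 1 :: int))"
    using pow2_mult_m_cong[of m "2 * k" x] by simp
  ultimately show ?thesis unfolding eqv_def using cong_trans cong_sym by blast
qed

lemma eqv_cong: "[x = y] (mod (2 ^ m + 1)) \<Longrightarrow> eqv m x y"
  unfolding eqv_def by (rule exI[of _ 0]) simp

lemma eqv_dvd:
  assumes "m > 0" "eqv m x y" "2 ^ m + 1 dvd y"
  shows "2 ^ m + 1 dvd x"
proof -
  from eqv_sym[OF assms(1,2)] obtain k where "[2 ^ k * y = x] (mod (2 ^ m + 1))"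
    unfolding eqv_def by blast
  then show ?thesis using assms(3) by (metis cong_dvd_iff dvd_mult)
qed

lemma mem_cyc_coset_iff:
  "j \<in> cyc_coset (2 ^ m + 1) x \<longleftrightarrow> j < 2 ^ m + 1 \<and> eqv m (int x) (int j)"
proof
  assume "j \<in> cyc_coset (2 ^ m + 1) x"
  then obtain k where k: "j = x * 2 ^ k mod (2 ^ m + 1)" by (auto simp: cyc_coset_def)
  then have "[x * 2 ^ k = j] (mod (2 ^ m + 1))" by (simp add: cong_def)
  then have "[int (x * 2 ^ k) = int j] (mod int (2 ^ m + 1))" by (simp only: cong_int_iff)
  then have "[2 ^ k * int x = int j] (mod (2 ^ m + 1))" by (simp add: mult.commute add.commute)
  then show "j < 2 ^ m + 1 \<and> eqv m (int x) (int j)" unfolding eqv_def using k by auto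
next
  assume "j < 2 ^ m + 1 \<and> eqv m (int x) (int j)"
  then obtain k where j: "j < 2 ^ m + 1" and "[2 ^ k * int x = int j] (mod (2 ^ m + 1))"
    unfolding eqv_def by blast
  then have "[int (x * 2 ^ k) = int j] (mod int (2 ^ m + 1))" by (simp add: mult.commute add.commute)
  then have "[x * 2 ^ k = j] (mod (2 ^ m + 1))" by (simp only: cong_int_iff)
  then have "j = x * 2 ^ k mod (2 ^ m + 1)" using j by (simp add: cong_def)
  then show "j \<in> cyc_coset (2 ^ m + 1) x" by (auto simp: cyc_coset_def)
qed

lemma cyc_coset_subset: "cyc_coset (2 ^ m + 1) x \<subseteq> {..<2 ^ m + 1}"
  unfolding subset_iff mem_cyc_coset_iff by simp

lemma finite_cyc_coset: "finite (cyc_coset (2 ^ m + 1) x)"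
  using cyc_coset_subset by (rule finite_subset) simp

text \<open>Every coset is closed under negation, so its least element is the least absolute value of
  an integer representing one of its members.\<close>

definition leader :: "nat \<Rightarrow> int \<Rightarrow> bool" where
  "leader m x \<longleftrightarrow> 0 < x \<and> (\<forall>y. eqv m x y \<longrightarrow> x \<le> \<bar>y\<bar>)"

text \<open>The exponents 0 < k < m suffice because m doublings only change the sign; k = 0 is
  covered by 2x < n. The strict inequality also rules out that the orbit closes early, which is what
  fixes the size of the coset.\<close>

definition strict_leader :: "nat \<Rightarrow> int \<Rightarrow> bool" where
  "strict_leader m x \<longleftrightarrow> 0 < x \<and> 2 * x < 2 ^ m + 1 \<and>
     (\<forall>k y. 0 < k \<and> k < m \<and> [2 ^ k * x = y] (mod (2 ^ m + 1)) \<longrightarrow> x < \<bar>y\<bar>)"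

lemma ex_leader:
  assumes "m > 0" "\<not> 2 ^ m + 1 dvd x"
  obtains l where "leader m l" "eqv m x l"
proof -
  have ex: "\<exists>a y. eqv m x y \<and> a = nat \<bar>y\<bar>" using eqv_refl by blast
  define a where "a = (LEAST a. \<exists>y. eqv m x y \<and> a = nat \<bar>y\<bar>)"
  from LeastI_ex[OF ex] obtain y where y: "eqv m x y" "a = nat \<bar>y\<bar>" unfolding a_def by blast
  have "y \<noteq> 0" using eqv_dvd[OF assms(1) y(1)] assms(2) by auto
  have abs: "eqv m x \<bar>y\<bar>" using y(1) eqv_trans[OF y(1) eqv_minus] by (simp add: abs_if)
  have "\<bar>y\<bar> \<le> \<bar>z\<bar>" if "eqv m \<bar>y\<bar> z" for z
  proof -
    have "a \<le> nat \<bar>z\<bar>" unfolding a_def using eqv_trans[OF abs that] by (intro Least_le) blast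
    then show ?thesis using y(2) by simp
  qed
  then have "leader m \<bar>y\<bar>" using \<open>y \<noteq> 0\<close> by (auto simp: leader_def)
  then show thesis using abs that by blast
qed

lemma leader_le:
  assumes "m > 0" "leader m l" "eqv m x l"
  shows "l \<le> \<bar>x\<bar>"
  using assms eqv_sym unfolding leader_def by blast

lemma leader_unique:
  assumes "m > 0" "leader m x" "leader m y" "eqv m x y"
  shows "x = y"
proof -
  have "x \<le> \<bar>y\<bar>" "y \<le> \<bar>x\<bar>" using assms eqv_sym unfolding leader_def by blast+
  then show ?thesis using assms(2,3) by (simp add: leader_def)
qed

lemma leader_odd:
  assumes "m > 0" "leader m x"
  shows "odd x"
proof
  assume "even x"
  then obtain y where y: "x = 2 * y" by blast
  have "eqv m y x" unfolding eqv_def by (rule exI[of _ 1]) (simp add: y)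
  from leader_le[OF assms this] show False using assms(2) y by (simp add: leader_def)
qed

text \<open>A number congruent to r and different from it is at least n away. Hence one
  representative r with absolute value between x and n - x bounds all of them, and orbit estimates
  reduce to exhibiting such an r.\<close>

lemma cong_abs_ge:
  fixes x y r n :: int
  assumes "[r = y] (mod n)" "\<bar>r\<bar> + x \<le> n" "x \<le> \<bar>r\<bar>"
  shows "x \<le> \<bar>y\<bar>"
proof (rule ccontr)
  assume "\<not> x \<le> \<bar>y\<bar>"
  then have "\<bar>r - y\<bar> < n" "r \<noteq> y" using assms(2,3) by auto
  moreover have "n dvd r - y" using assms(1) by (simp add: cong_iff_dvd_diff)
  ultimately show False using dvd_imp_le_int[of "r - y" n] by simp
qed

lemma cong_abs_gt:
  fixes x y r n :: int
  assumes "[r = y] (mod n)" "\<bar>r\<bar> + x < n" "x < \<bar>r\<bar>"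
  shows "x < \<bar>y\<bar>"
  using cong_abs_ge[of r y n "x + 1"] assms by simp

text \<open>Write an arbitrary exponent as k = ma + r with r < m; the factor 2^(ma) is only the sign
  (-1)^a.\<close>

lemma strict_leader_imp_leader:
  assumes "strict_leader m x"
  shows "leader m x"
  unfolding leader_def
proof (intro conjI allI impI)
  show "0 < x" using assms by (simp add: strict_leader_def)
  fix y assume "eqv m x y"
  then obtain k where k: "[2 ^ k * x = y] (mod (2 ^ m + 1))" unfolding eqv_def by blast
  have m: "m > 0" using assms by (cases m) (auto simp: strict_leader_def)
  define a r where "a = k div m" and "r = k mod m"
  have kar: "k = m * a + r" by (simp add: a_def r_def)
  have "[2 ^ (m * a) * (2 ^ r * x) = (-1) ^ a * (2 ^ r * x)] (mod (2 ^ m + 1))"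
    by (rule pow2_mult_m_cong)
  then have "[(-1) ^ a * (2 ^ r * x) = y] (mod (2 ^ m + 1))"
    using k unfolding kar by (simp add: power_add mult.assoc) (metis cong_sym cong_trans)
  then have "[(-1) ^ a * ((-1) ^ a * (2 ^ r * x)) = (-1) ^ a * y] (mod (2 ^ m + 1))"
    by (intro cong_mult cong_refl)
  then have c: "[2 ^ r * x = (-1) ^ a * y] (mod (2 ^ m + 1))"
    by (simp flip: mult.assoc power_add mult_2)
  have abs: "\<bar>(-1) ^ a * y\<bar> = \<bar>y\<bar>" by (simp add: abs_mult)
  show "x \<le> \<bar>y\<bar>"
  proof (cases "r = 0")
    case True
    then have "[x = (-1) ^ a * y] (mod (2 ^ m + 1))" using c by simp
    from cong_abs_ge[OF this, of x] show ?thesis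
      using assms abs by (simp add: strict_leader_def)
  next
    case False
    moreover have "r < m" using m by (simp add: r_def)
    ultimately have "x < \<bar>(-1) ^ a * y\<bar>" using assms c unfolding strict_leader_def by blast
    then show ?thesis using abs by simp
  qed
qed

section \<open>Sizes of cosets and of their unions\<close>

lemma coprime_pow2_mod: "m > 0 \<Longrightarrow> coprime (2 ^ k) (2 ^ m + 1 :: int)"
  by (rule coprime_power_left_iff[THEN iffD2]) (simp add: coprime_left_2_iff_odd)

text \<open>If two of the first 2m multiples agreed, x would meet itself after d < m doublings, or
  its own negative after d - m. Both have absolute value x, against strictness; the case d = m would
  give n dividing 2x.\<close>

lemma card_strict_leader_coset:
  assumes m: "m > 0" and x: "strict_leader m (int x)"
  shows "card (cyc_coset (2 ^ m + 1) x) = 2 * m"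
proof -
  let ?n = "2 ^ m + 1 :: int" and ?f = "\<lambda>k. x * 2 ^ k mod (2 ^ m + 1)"
  have x0: "0 < int x" "2 * int x < ?n" using x by (auto simp: strict_leader_def)
  have period: "\<not> [2 ^ d * int x = int x] (mod ?n)" if d: "0 < d" "d < 2 * m" for d
  proof
    assume c: "[2 ^ d * int x = int x] (mod ?n)"
    show False
    proof (cases "d < m")
      case True
      then show False using x c d unfolding strict_leader_def by force
    next
      case False
      then have de: "d = m + (d - m)" by simp
      have "[2 ^ m * (2 ^ (d - m) * int x) = - (2 ^ (d - m) * int x)] (mod ?n)"
        by (rule pow2_m_cong)
      then have "[2 ^ d * int x = - (2 ^ (d - m) * int x)] (mod ?n)"
        by (subst de) (simp add: power_add mult.assoc)
      then have "[- (2 ^ (d - m) * int x) = int x] (mod ?n)" using c cong_sym cong_trans by blast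
      then have c': "[2 ^ (d - m) * int x = - int x] (mod ?n)"
        using cong_minus_minus_iff[of "2 ^ (d - m) * int x" "- int x" ?n] by simp
      show False
      proof (cases "d = m")
        case True
        then have "?n dvd 2 * int x" using c' by (simp add: cong_iff_dvd_diff)
        then show False using x0 zdvd_imp_le by fastforce
      next
        case neq: False
        then have "0 < d - m" "d - m < m" using False d by auto
        then have "int x < \<bar>- int x\<bar>" using x c' unfolding strict_leader_def by blast
        then show False by simp
      qed
    qed
  qed
  have shift: False if "?f (i + d) = ?f i" "0 < d" "d < 2 * m" for i d
  proof -
    have "[x * 2 ^ (i + d) = x * 2 ^ i] (mod (2 ^ m + 1))" using that by (simp add: cong_def)
    then have "[int (x * 2 ^ (i + d)) = int (x * 2 ^ i)] (mod int (2 ^ m + 1))"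
      by (simp only: cong_int_iff)
    then have "[2 ^ i * (2 ^ d * int x) = 2 ^ i * int x] (mod ?n)"
      by (simp add: power_add ac_simps)
    then have "[2 ^ d * int x = int x] (mod ?n)"
      using coprime_pow2_mod[OF m] by (simp add: cong_mult_lcancel)
    then show False using period that by blast
  qed
  have inj: "inj_on ?f {..<2 * m}"
  proof (rule linorder_inj_onI)
    fix i j assume ij: "i < j" "i \<in> {..<2 * m}" "j \<in> {..<2 * m}"
    then have "j - i < 2 * m" "0 < j - i" "i + (j - i) = j" by auto
    then show "?f i \<noteq> ?f j" using shift[of i "j - i"] by metis
  qed auto
  have "cyc_coset (2 ^ m + 1) x = ?f ` {..<2 * m}"
  proof (intro equalityI subsetI)
    fix y assume "y \<in> cyc_coset (2 ^ m + 1) x"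
    then obtain k where y: "y = ?f k" by (auto simp: cyc_coset_def)
    have "[2 ^ (m * (2 * (k div (2 * m)))) * (2 ^ (k mod (2 * m)) * int x)
          = 2 ^ (k mod (2 * m)) * int x] (mod ?n)"
      using pow2_mult_m_cong[of m "2 * (k div (2 * m))"] by simp
    moreover have "m * (2 * (k div (2 * m))) + k mod (2 * m) = k"
      by (simp only: mult.assoc[symmetric] mult.commute[of m 2] mult_div_mod_eq)
    ultimately have "[2 ^ k * int x = 2 ^ (k mod (2 * m)) * int x] (mod ?n)"
      by (simp flip: mult.assoc power_add)
    then have "[int (x * 2 ^ k) = int (x * 2 ^ (k mod (2 * m)))] (mod int (2 ^ m + 1))"
      by (simp add: ac_simps)
    then have "[x * 2 ^ k = x * 2 ^ (k mod (2 * m))] (mod (2 ^ m + 1))"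
      by (simp only: cong_int_iff)
    then have "y = ?f (k mod (2 * m))" by (simp add: y cong_def)
    then show "y \<in> ?f ` {..<2 * m}" using m by auto
  qed (auto simp: cyc_coset_def)
  then show ?thesis using card_image[OF inj] by simp
qed

definition cosets_below :: "nat \<Rightarrow> nat \<Rightarrow> nat set" where
  "cosets_below m \<delta> = (\<Union>x\<in>{1..<\<delta>}. cyc_coset (2 ^ m + 1) x)"

lemma mem_cosets_below:
  "j \<in> cosets_below m \<delta> \<longleftrightarrow>
    j < 2 ^ m + 1 \<and> (\<exists>x. 1 \<le> x \<and> x < \<delta> \<and> eqv m (int x) (int j))"
  unfolding cosets_below_def UN_iff mem_cyc_coset_iff by auto

lemma finite_cosets_below: "finite (cosets_below m \<delta>)"
  unfolding cosets_below_def using finite_cyc_coset by blast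

lemma cosets_below_subset:
  assumes "m > 0" "\<delta> \<le> 2 ^ m + 1"
  shows "cosets_below m \<delta> \<subseteq> {1..<2 ^ m + 1}"
proof
  fix j assume "j \<in> cosets_below m \<delta>"
  then obtain x where x: "x \<in> {1..<\<delta>}" "j < 2 ^ m + 1" "eqv m (int x) (int j)"
    by (auto simp: mem_cosets_below)
  have "j \<noteq> 0"
  proof
    assume "j = 0"
    then have "2 ^ m + 1 dvd int x" using eqv_dvd[OF assms(1) x(3)] by simp
    then have "int (2 ^ m + 1) dvd int x" by (simp add: add.commute)
    then have "2 ^ m + 1 dvd x" by (simp only: int_dvd_int_iff)
    then show False using x(1) assms(2) by (auto dest: dvd_imp_le)
  qed
  then show "j \<in> {1..<2 ^ m + 1}" using x(2) by simp
qed

lemma not_dvd_small: "0 < j \<Longrightarrow> j < 2 ^ m + 1 \<Longrightarrow> \<not> 2 ^ m + 1 dvd int j"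
proof
  assume j: "0 < j" "j < 2 ^ m + 1" "2 ^ m + 1 dvd int j"
  then have "2 ^ m + 1 \<le> int j" using zdvd_imp_le by simp
  then have "int (2 ^ m + 1) \<le> int j" by simp
  then show False using j(2) by linarith
qed

lemma mem_cosets_below_iff:
  assumes "m > 0" "leader m (int l)" "eqv m (int j) (int l)" "j < 2 ^ m + 1"
  shows "j \<in> cosets_below m \<delta> \<longleftrightarrow> l < \<delta>"
proof
  assume "j \<in> cosets_below m \<delta>"
  then obtain x where x: "x \<in> {1..<\<delta>}" "eqv m (int x) (int j)"
    by (auto simp: mem_cosets_below)
  have "int l \<le> \<bar>int x\<bar>" using leader_le[OF assms(1,2) eqv_trans[OF x(2) assms(3)]] .
  then show "l < \<delta>" using x(1) by simp
next
  assume "l < \<delta>"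
  moreover have "1 \<le> l" using assms(2) by (auto simp: leader_def)
  moreover have "j \<in> cyc_coset (2 ^ m + 1) l"
    using eqv_sym[OF assms(1,3)] assms(4) unfolding mem_cyc_coset_iff by blast
  ultimately show "j \<in> cosets_below m \<delta>" unfolding cosets_below_def by auto
qed

lemma card_disjoint_leader_cosets:
  assumes m: "m > 0" and "finite L" and "\<And>x. x \<in> L \<Longrightarrow> leader m (int x)"
  shows "card (\<Union>x\<in>L. cyc_coset (2 ^ m + 1) x) = (\<Sum>x\<in>L. card (cyc_coset (2 ^ m + 1) x))"
proof (rule card_UN_disjoint)
  show "\<forall>i\<in>L. \<forall>j\<in>L. i \<noteq> j \<longrightarrow> cyc_coset (2 ^ m + 1) i \<inter> cyc_coset (2 ^ m + 1) j = {}"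
  proof (intro ballI impI)
    fix i j assume ij: "i \<in> L" "j \<in> L" "i \<noteq> j"
    { fix y assume "y \<in> cyc_coset (2 ^ m + 1) i" "y \<in> cyc_coset (2 ^ m + 1) j"
      then have "eqv m (int i) (int y)" "eqv m (int j) (int y)"
        unfolding mem_cyc_coset_iff by blast+
      then have "eqv m (int i) (int j)" using eqv_sym[OF m] eqv_trans by blast
      then have False using leader_unique[OF m assms(3)[OF ij(1)] assms(3)[OF ij(2)]] ij(3) by simp }
    then show "cyc_coset (2 ^ m + 1) i \<inter> cyc_coset (2 ^ m + 1) j = {}" by blast
  qed
qed (use assms finite_cyc_coset in auto)

text \<open>\<open>red\<close> asks only for some smaller positive member of the orbit, not for its
  leader; well-founded descent then ends in \<open>L\<close>.\<close>

lemma card_cosets_below: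
  assumes m: "m > 0" and L: "L \<subseteq> {1..<\<delta>}"
    and lead: "\<And>x. x \<in> L \<Longrightarrow> strict_leader m (int x)"
    and red: "\<And>x. x \<in> {1..<\<delta>} - L \<Longrightarrow> \<exists>y. 0 < y \<and> y < x \<and> eqv m (int x) (int y)"
  shows "card (cosets_below m \<delta>) = 2 * m * card L"
proof -
  have fin: "finite L" using L finite_subset by auto
  have ex: "\<exists>l\<in>L. eqv m (int l) (int x)" if "x \<in> {1..<\<delta>}" for x
    using that
  proof (induction x rule: less_induct)
    case (less x)
    show ?case
    proof (cases "x \<in> L")
      case True
      then show ?thesis using eqv_refl by blast
    next
      case False
      then obtain y where y: "0 < y" "y < x" "eqv m (int x) (int y)" using red less.prems by blast
      then obtain l where "l \<in> L" "eqv m (int l) (int y)" using less by fastforce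
      then show ?thesis using y(3) eqv_sym[OF m] eqv_trans by blast
    qed
  qed
  have "cosets_below m \<delta> = (\<Union>x\<in>L. cyc_coset (2 ^ m + 1) x)"
  proof (intro equalityI subsetI)
    fix j assume "j \<in> cosets_below m \<delta>"
    then obtain x where x: "x \<in> {1..<\<delta>}" "j < 2 ^ m + 1" "eqv m (int x) (int j)"
      by (auto simp: mem_cosets_below)
    from ex[OF x(1)] obtain l where "l \<in> L" "eqv m (int l) (int x)" by blast
    then have "j \<in> cyc_coset (2 ^ m + 1) l"
      using x eqv_trans unfolding mem_cyc_coset_iff by blast
    then show "j \<in> (\<Union>x\<in>L. cyc_coset (2 ^ m + 1) x)" using \<open>l \<in> L\<close> by blast
  qed (use L in \<open>auto simp: cosets_below_def\<close>)
  then have "card (cosets_below m \<delta>) = (\<Sum>x\<in>L. card (cyc_coset (2 ^ m + 1) x))"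
    using card_disjoint_leader_cosets[OF m fin] lead strict_leader_imp_leader by simp
  also have "\<dots> = (\<Sum>x\<in>L. 2 * m)"
    by (intro sum.cong refl card_strict_leader_coset[OF m lead])
  finally show ?thesis by (simp add: mult.commute)
qed

section \<open>Parameters of BCH codes from their defining sets\<close>

locale primitive_root =
  fixes \<xi> :: "'f::field" and m :: nat
  assumes char2: "CHAR('f) = 2" and m: "m > 0"
    and one: "\<xi> ^ (2 ^ m + 1) = 1"
    and prim: "\<And>k. 0 < k \<Longrightarrow> k < 2 ^ m + 1 \<Longrightarrow> \<xi> ^ k \<noteq> 1"
begin

lemma nz: "\<xi> \<noteq> 0"
  using one by (metis power_0_left add_is_0 one_neq_zero zero_neq_one)

lemma inj_pow: "inj_on (\<lambda>i. \<xi> ^ i) {..<2 ^ m + 1}"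
proof (rule linorder_inj_onI)
  fix i j :: nat assume ij: "i < j" "i \<in> {..<2 ^ m + 1}" "j \<in> {..<2 ^ m + 1}"
  show "\<xi> ^ i \<noteq> \<xi> ^ j"
  proof
    assume "\<xi> ^ i = \<xi> ^ j"
    also have "\<dots> = \<xi> ^ i * \<xi> ^ (j - i)" using ij by (simp flip: power_add)
    finally have "\<xi> ^ (j - i) = 1" using nz by simp
    moreover have "0 < j - i" "j - i < 2 ^ m + 1" using ij by auto
    ultimately show False using prim by blast
  qed
qed auto

lemma coset_double:
  assumes "j \<in> cyc_coset (2 ^ m + 1) x"
  shows "2 * j mod (2 ^ m + 1) \<in> cyc_coset (2 ^ m + 1) x"
proof -
  from assms obtain k where "j = x * 2 ^ k mod (2 ^ m + 1)" by (auto simp: cyc_coset_def)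
  then have "2 * j mod (2 ^ m + 1) = x * 2 ^ Suc k mod (2 ^ m + 1)"
    by (simp add: mod_mult_right_eq ac_simps)
  then show ?thesis unfolding cyc_coset_def by blast
qed

lemma card_code:
  assumes "D = (\<Union>x\<in>X. cyc_coset (2 ^ m + 1) x)"
  shows "card (bin_cyclic_code \<xi> (2 ^ m + 1) D) = 2 ^ (2 ^ m + 1 - card D)"
proof (rule card_bin_cyclic_code[OF char2 _ _ _ one inj_pow])
  show "odd (2 ^ m + 1 :: nat)" using m by simp
  show "D \<subseteq> {..<2 ^ m + 1}" unfolding assms using cyc_coset_subset by blast
  show "2 * j mod (2 ^ m + 1) \<in> D" if "j \<in> D" for j
    using that coset_double unfolding assms by blast
qed

lemma power_mod: "\<xi> ^ (i * (j mod (2 ^ m + 1))) = \<xi> ^ (i * j)"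
proof -
  have "\<xi> ^ (i * j) = \<xi> ^ (i * ((2 ^ m + 1) * (j div (2 ^ m + 1)) + j mod (2 ^ m + 1)))"
    by (simp only: mult_div_mod_eq)
  also have "\<dots> = (\<xi> ^ (2 ^ m + 1)) ^ (i * (j div (2 ^ m + 1))) * \<xi> ^ (i * (j mod (2 ^ m + 1)))"
    unfolding power_mult[symmetric] power_add[symmetric] by (simp only: algebra_simps)
  finally show ?thesis unfolding one by simp
qed

text \<open>The exponents in the window are reduced modulo n before membership in \<open>D\<close>
  is tested, so the window may wrap around 0.\<close>

lemma min_dist_ge:
  assumes card: "card (bin_cyclic_code \<xi> (2 ^ m + 1) D) = 2 ^ k" "k > 0"
    and D: "\<And>j. b \<le> j \<Longrightarrow> j < b + d - 1 \<Longrightarrow> j mod (2 ^ m + 1) \<in> D"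
  shows "d \<le> min_dist (bin_cyclic_code \<xi> (2 ^ m + 1) D)"
proof -
  let ?C = "bin_cyclic_code \<xi> (2 ^ m + 1) D"
  \<comment> \<open>A positive dimension guarantees a nonzero word, so the infimum in
    \<open>min_dist\<close> is taken over a nonempty set.\<close>
  have "?C - {{}} \<noteq> {}"
  proof
    assume "?C - {{}} = {}"
    then have "card ?C \<le> card {{} :: nat set}" by (intro card_mono) auto
    moreover have "2 ^ 1 \<le> (2 :: nat) ^ k" using card(2) by (intro power_increasing) auto
    ultimately show False using card(1) by simp
  qed
  moreover have "d \<le> card S" if S: "S \<in> ?C - {{}}" for S
  proof (rule bch_bound[of \<xi>])
    have sub: "S \<subseteq> {..<2 ^ m + 1}" using S by (auto simp: bin_cyclic_code_def)
    show "inj_on (\<lambda>i. \<xi> ^ i) S" using inj_on_subset[OF inj_pow sub] .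
    show "finite S" using sub finite_subset by auto
    show "S \<noteq> {}" using S by simp
    show "\<xi> \<noteq> 0" by (rule nz)
    fix j assume "b \<le> j" "j < b + d - 1"
    then have "(\<Sum>i\<in>S. \<xi> ^ (i * (j mod (2 ^ m + 1)))) = 0"
      using S D by (auto simp: bin_cyclic_code_def)
    then show "(\<Sum>i\<in>S. \<xi> ^ (i * j)) = 0" by (simp only: power_mod)
  qed
  ultimately show ?thesis unfolding min_dist_def by (intro cInf_greatest) auto
qed

text \<open>The designed distance may be replaced by any delta' that yields the same defining set;
  this is how the bounds a + 5 and delta_i arise for smaller delta.\<close>

lemma bch_code_params_1:
  assumes D: "cosets_below m \<delta> = cosets_below m \<delta>'" and le: "\<delta>' \<le> 2 ^ m + 1"
    and k: "k = 2 ^ m + 1 - card (cosets_below m \<delta>)" "0 < k"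
  shows "code_params (bch_code \<xi> (2 ^ m + 1) \<delta> 1) k \<delta>'"
proof -
  have code: "bch_code \<xi> (2 ^ m + 1) \<delta> 1 = bin_cyclic_code \<xi> (2 ^ m + 1) (cosets_below m \<delta>)"
    by (simp add: bch_code_def cosets_below_def)
  have card: "card (bin_cyclic_code \<xi> (2 ^ m + 1) (cosets_below m \<delta>)) = 2 ^ k"
    unfolding k(1) by (rule card_code) (rule cosets_below_def)
  moreover have "\<delta>' \<le> min_dist (bin_cyclic_code \<xi> (2 ^ m + 1) (cosets_below m \<delta>))"
  proof (rule min_dist_ge[OF card k(2), where b = 1])
    fix j assume j: "1 \<le> j" "j < 1 + \<delta>' - 1"
    then have "j mod (2 ^ m + 1) = j" using le by simp
    then show "j mod (2 ^ m + 1) \<in> cosets_below m \<delta>"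
      using j le eqv_refl unfolding D by (auto simp: mem_cosets_below)
  qed
  ultimately show ?thesis unfolding code code_params_def by simp
qed

lemma bch_code_params_0:
  assumes D: "cosets_below m \<delta> = cosets_below m \<delta>'" and le: "\<delta>' \<le> 2 ^ m + 1"
    and pos: "0 < \<delta>" "\<delta> \<le> \<delta>'"
    and k: "k = 2 ^ m - card (cosets_below m \<delta>)" "0 < k"
  shows "code_params (bch_code \<xi> (2 ^ m + 1) (\<delta> + 1) 0) k (2 * \<delta>')"
proof -
  let ?n = "2 ^ m + 1 :: nat"
  have c0: "cyc_coset ?n 0 = {0}" by (auto simp: cyc_coset_def)
  have D0: "(\<Union>x\<in>{0..<\<delta>}. cyc_coset ?n x) = insert 0 (cosets_below m \<delta>)"
  proof -
    have "{0..<\<delta>} = insert 0 {1..<\<delta>}" using pos by auto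
    then show ?thesis unfolding cosets_below_def by (simp only: UN_insert c0 insert_is_Un[symmetric])
  qed
  have code: "bch_code \<xi> ?n (\<delta> + 1) 0 = bin_cyclic_code \<xi> ?n (insert 0 (cosets_below m \<delta>))"
    unfolding bch_code_def D0[symmetric] by simp
  have "0 \<notin> cosets_below m \<delta>" using cosets_below_subset[OF m, of \<delta>'] le D by auto
  then have "2 ^ m + 1 - card (insert 0 (cosets_below m \<delta>)) = k"
    using finite_cosets_below by (simp add: k)
  then have card: "card (bin_cyclic_code \<xi> ?n (insert 0 (cosets_below m \<delta>))) = 2 ^ k"
    using card_code[OF D0[symmetric]] by simp
  moreover have "2 * \<delta>' \<le> min_dist (bin_cyclic_code \<xi> ?n (insert 0 (cosets_below m \<delta>)))"
  \<comment> \<open>The start represents -(delta' - 1), and the 2 delta' - 1 consecutive exponents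
    run up to delta' - 1.\<close>
  proof (rule min_dist_ge[OF card k(2), where b = "?n - (\<delta>' - 1)"])
    fix j assume j: "?n - (\<delta>' - 1) \<le> j" "j < ?n - (\<delta>' - 1) + 2 * \<delta>' - 1"
    show "j mod ?n \<in> insert 0 (cosets_below m \<delta>)"
    proof (cases "j < ?n")
      case True
      \<comment> \<open>Before the wrap, j represents -(n - j), and n - j < delta' lies in the same
        orbit up to sign.\<close>
      have "- int (?n - j) - int j = - (2 ^ m + 1)" using True by (simp add: of_nat_diff)
      then have "2 ^ m + 1 dvd - int (?n - j) - int j" by (metis dvd_minus_iff dvd_refl)
      then have "eqv m (- int (?n - j)) (int j)"
        by (intro eqv_cong) (simp add: cong_iff_dvd_diff)
      then have "eqv m (int (?n - j)) (int j)" using eqv_trans eqv_minus by blast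
      moreover have "1 \<le> ?n - j" "?n - j < \<delta>'" using True j pos le by linarith+
      ultimately have "j \<in> cosets_below m \<delta>'" using True unfolding mem_cosets_below by blast
      then show ?thesis using True by (simp add: D)
    next
      case False
      then have jm: "j - ?n < \<delta>'" "j - ?n < ?n" using j le pos by linarith+
      have "j mod ?n = (j - ?n) mod ?n" using False by (subst le_mod_geq) auto
      also have "\<dots> = j - ?n" using jm(2) by (rule mod_less)
      finally have "j mod ?n = j - ?n" .
      moreover have "j - ?n \<in> cosets_below m \<delta>'" if "j \<noteq> ?n"
      proof -
        have "1 \<le> j - ?n" "j - ?n < 2 ^ m + 1" using that False jm le by linarith+
        then show ?thesis using jm(1) eqv_refl unfolding mem_cosets_below by blast
      qed
      ultimately show ?thesis unfolding D by (cases "j = ?n") simp_all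
    qed
  qed
  ultimately show ?thesis unfolding code code_params_def by simp
qed

end

section \<open>Coset leaders of the size of the square root of the modulus\<close>

text \<open>With r = 2^(2t) the modulus becomes 4r^2 + 1, so that congruences can be checked as
  polynomial identities in r.\<close>

lemma power_m_eq: "(2::'a::comm_semiring_1) ^ (4 * t + 2) = 4 * (2 ^ (2 * t))\<^sup>2"
proof -
  have "(2::'a) ^ (4 * t + 2) = 2 ^ (2 * t) * 2 ^ (2 * t) * 2\<^sup>2"
    unfolding power_add[symmetric] by (rule arg_cong) simp
  then show ?thesis by (simp add: power2_eq_square mult.commute)
qed

lemma power_2t_ge:
  assumes "t \<ge> 2"
  shows "16 \<le> (2::'a::linordered_semidom) ^ (2 * t)"
proof -
  have "(2::'a) ^ 4 \<le> 2 ^ (2 * t)" using assms by (intro power_increasing) auto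
  then show ?thesis by simp
qed

text \<open>Writing $2^k x - y = l(4r^2+1)$ with $2^k s = 2r$ and $w = x - 2rls$ gives
  $y = 2^k w - l$; the size bounds leave only $l \in \{1,3\}$, $s \in \{1,2\}$ and $|w| \le 6$.\<close>

lemma small_cong_solutions:
  fixes x y r :: int
  assumes r: "r = 2 ^ (2 * t)" "r \<ge> 16" and k: "0 < k" "k \<le> 2 * t + 1"
    and x: "odd x" "0 < x" "x \<le> 6 * r + 4" and y: "odd y" "\<bar>y\<bar> \<le> 6 * r + 4"
    and c: "[2 ^ k * x = y] (mod (4 * r\<^sup>2 + 1))"
  shows "(x = 2*r+1 \<and> \<bar>y\<bar> = 2*r-1) \<or> (x = 2*r-1 \<and> \<bar>y\<bar> = 2*r+1) \<or>
    (x = 2*r+3 \<and> \<bar>y\<bar> = 6*r-1) \<or> (x = 2*r-3 \<and> \<bar>y\<bar> = 6*r+1) \<or>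
    (x = 6*r+1 \<and> \<bar>y\<bar> = 2*r-3) \<or> (x = 6*r-1 \<and> \<bar>y\<bar> = 2*r+3) \<or>
    (x = 6*r+3 \<and> \<bar>y\<bar> = 6*r-3) \<or> (x = 6*r-3 \<and> \<bar>y\<bar> = 6*r+3) \<or>
    (x = 4*r+1 \<and> \<bar>y\<bar> = r-1) \<or> (x = 4*r-1 \<and> \<bar>y\<bar> = r+1) \<or>
    (x = 4*r+3 \<and> \<bar>y\<bar> = 3*r-1) \<or> (x = 4*r-3 \<and> \<bar>y\<bar> = 3*r+1) \<or>
    (x = 4*r+5 \<and> \<bar>y\<bar> = 5*r-1) \<or> (x = 4*r-5 \<and> \<bar>y\<bar> = 5*r+1)"
proof -
  define p :: int where "p = 2 ^ k"
  define h where "h = 2 * t + 1 - k"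
  define s :: int where "s = 2 ^ h"
  have ps: "p * s = 2 * r"
    unfolding p_def s_def h_def r(1) using k by (simp flip: power_add power_Suc)
  have "even p" using k by (simp add: p_def)
  have p2: "2 \<le> p" unfolding p_def using k by (cases k) auto
  have s1: "1 \<le> s" unfolding s_def by simp
  have p2r: "p \<le> 2 * r" using ps s1 p2 mult_left_mono[of 1 s p] by simp
  define M where "M = 4 * r\<^sup>2 + 1"
  from c obtain l where l: "p * x - y = l * M"
    unfolding cong_iff_dvd_diff p_def M_def by (metis dvdE mult.commute)
  have "odd (p * x - y)" using \<open>even p\<close> y(1) by simp
  then have "odd l" unfolding l by auto
  have "0 < l"
  proof (rule ccontr)
    assume "\<not> 0 < l"
    then have "l \<le> -1" using \<open>odd l\<close> by (cases "l = 0") auto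
    then have "l * M \<le> -1 * M" by (intro mult_right_mono) (auto simp: M_def)
    moreover have "0 < p * x" using p2 x by simp
    moreover have "16 * r \<le> r\<^sup>2" using r(2) by (simp add: power2_eq_square)
    ultimately show False using l y(2) r(2) M_def by linarith
  qed
  have "l < 4"
  proof (rule ccontr)
    assume "\<not> l < 4"
    then have "4 * M \<le> l * M" by (intro mult_right_mono) (auto simp: M_def)
    moreover have "p * x \<le> 2 * r * (6 * r + 4)" using p2r x r p2 by (intro mult_mono) auto
    moreover have "2 * r * (6 * r + 4) = 12 * r\<^sup>2 + 8 * r" by (simp add: power2_eq_square algebra_simps)
    moreover have "16 * r \<le> r\<^sup>2" using r(2) by (simp add: power2_eq_square)
    ultimately show False using l y(2) r(2) M_def by linarith
  qed
  have l13: "l = 1 \<or> l = 3"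
  proof -
    have "l \<in> {1,2,3}" using \<open>0 < l\<close> \<open>l < 4\<close> by auto
    then show ?thesis using \<open>odd l\<close> by auto
  qed
  define w where "w = x - 2 * r * l * s"
  have yw: "y = p * w - l"
  proof -
    have "p * w - l = p * x - (p * s) * (2 * r * l) - l" unfolding w_def by (simp add: algebra_simps)
    also have "\<dots> = p * x - l * M" unfolding ps M_def by (simp add: power2_eq_square algebra_simps)
    finally show ?thesis using l by simp
  qed
  have pw: "p * \<bar>w\<bar> \<le> 6 * r + 7"
  proof -
    have "p * \<bar>w\<bar> = \<bar>y + l\<bar>" unfolding yw using p2 by (simp add: abs_mult)
    then show ?thesis using y(2) l13 by auto
  qed
  have "odd w" unfolding w_def using x(1) by simp
  \<comment> \<open>p |w| is at most 6r + 7, while p times 4s is 8r. So x is pinned down to within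
    4s of 2rls.\<close>
  have w4: "\<bar>w\<bar> < 4 * s"
  proof (rule ccontr)
    assume "\<not> \<bar>w\<bar> < 4 * s"
    then have "p * (4 * s) \<le> p * \<bar>w\<bar>" using p2 by (intro mult_left_mono) auto
    moreover have "p * (4 * s) = 8 * r" using ps by simp
    ultimately show False using pw r by linarith
  qed
  have xl: "s * (2 * r * l - 4) < x"
    using w4 unfolding w_def by (simp add: algebra_simps abs_less_iff)
  consider "h = 0" | "h = 1" | "h \<ge> 2" by linarith
  then show ?thesis
  proof cases
    case 1
    then have s: "s = 1" by (simp add: s_def)
    then have p: "p = 2 * r" using ps by simp
    have "\<bar>w\<bar> < 4" using w4 s by simp
    then have "-4 < w" "w < 4" by linarith+
    then have "w = -3 \<or> w = -1 \<or> w = 1 \<or> w = 3" using \<open>odd w\<close> by presburger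
    moreover have "x = 2 * r * l + w" using s by (simp add: w_def)
    moreover have "\<bar>y\<bar> = (if 0 < w then 2 * r * w - l else l - 2 * r * w)"
      using calculation(1) l13 r(2) unfolding yw p by (elim disjE) simp_all
    ultimately show ?thesis using l13 by (elim disjE) simp_all
  next
    case 2
    then have s: "s = 2" by (simp add: s_def)
    then have p: "p = r" using ps by simp
    have "l = 1" using xl l13 x(3) r(2) unfolding s by auto
    have "\<bar>w\<bar> < 7"
    proof (rule ccontr)
      assume "\<not> \<bar>w\<bar> < 7"
      then have "r * 7 \<le> r * \<bar>w\<bar>" using r by (intro mult_left_mono) auto
      then show False using pw r(2) unfolding p by linarith
    qed
    then have "-7 < w" "w < 7" by linarith+
    then have "w = -5 \<or> w = -3 \<or> w = -1 \<or> w = 1 \<or> w = 3 \<or> w = 5"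
      using \<open>odd w\<close> by presburger
    moreover have "x = 4 * r + w" using s \<open>l = 1\<close> by (simp add: w_def)
    moreover have "\<bar>y\<bar> = (if 0 < w then r * w - 1 else 1 - r * w)"
      using calculation(1) r(2) unfolding yw p \<open>l = 1\<close> by (elim disjE) simp_all
    ultimately show ?thesis by (elim disjE) simp_all
  next
    case 3
    \<comment> \<open>For s at least 4, x would exceed 4(2r - 4) = 8r - 16, beyond the range 6r + 4
      because r is at least 16.\<close>
    then have "2 ^ 2 \<le> s" unfolding s_def by (intro power_increasing) auto
    moreover have "2 * r - 4 \<le> 2 * r * l - 4" using l13 r(2) by auto
    ultimately have "4 * (2 * r - 4) \<le> s * (2 * r * l - 4)" using r(2) by (intro mult_mono) auto
    also note xl
    finally have False using x(3) r(2) by simp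
    then show ?thesis ..
  qed
qed

text \<open>The fourteen solutions of \<open>small_cong_solutions\<close> form ten unordered pairs
  of numbers in a common orbit; these are the larger members.\<close>

definition small_nonleaders :: "nat \<Rightarrow> nat set" where
  "small_nonleaders r = {2*r+1, 4*r-3, 4*r-1, 4*r+1, 4*r+3, 5*r-1, 5*r+1, 6*r-1, 6*r+1, 6*r+3}"

text \<open>Induction on the exponent disposes of even y: half of y is reached one doubling earlier
  and is already larger than x. What remains is odd y, to which the list of solutions applies in one
  of the two directions.\<close>

lemma small_strict_leader:
  assumes t: "t \<ge> 2" and r: "r = 2 ^ (2 * t)"
    and x: "odd x" "x \<le> 6 * r + 4" "x \<notin> small_nonleaders r"
  shows "strict_leader (4 * t + 2) (int x)"
proof -
  let ?m = "4 * t + 2" and ?n = "2 ^ (4 * t + 2) + 1 :: int"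
  have r16: "16 \<le> r" unfolding r by (rule power_2t_ge[OF t])
  have ir: "int r = 2 ^ (2 * t)" by (simp add: r)
  have n: "?n = 4 * (int r)\<^sup>2 + 1" unfolding power_m_eq ir ..
  have "16 * int r \<le> (int r)\<^sup>2" using r16 by (simp add: power2_eq_square)
  then have x2: "2 * int x < ?n" unfolding n using x(2) r16 by linarith
  have x0: "0 < int x" using x(1) by (cases x) auto
  have nonl: "int x \<noteq> int a" if "a \<in> small_nonleaders r" for a using that x(3) by auto
  have n1: "int x \<noteq> 2 * int r + 1" using nonl[of "2*r+1"] r16 by (simp add: small_nonleaders_def of_nat_diff)
  have n2: "int x \<noteq> 4 * int r - 3" using nonl[of "4*r-3"] r16 by (simp add: small_nonleaders_def of_nat_diff)
  have n3: "int x \<noteq> 4 * int r - 1" using nonl[of "4*r-1"] r16 by (simp add: small_nonleaders_def of_nat_diff)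
  have n4: "int x \<noteq> 4 * int r + 1" using nonl[of "4*r+1"] r16 by (simp add: small_nonleaders_def of_nat_diff)
  have n5: "int x \<noteq> 4 * int r + 3" using nonl[of "4*r+3"] r16 by (simp add: small_nonleaders_def of_nat_diff)
  have n6: "int x \<noteq> 5 * int r - 1" using nonl[of "5*r-1"] r16 by (simp add: small_nonleaders_def of_nat_diff)
  have n7: "int x \<noteq> 5 * int r + 1" using nonl[of "5*r+1"] r16 by (simp add: small_nonleaders_def of_nat_diff)
  have n8: "int x \<noteq> 6 * int r - 1" using nonl[of "6*r-1"] r16 by (simp add: small_nonleaders_def of_nat_diff)
  have n9: "int x \<noteq> 6 * int r + 1" using nonl[of "6*r+1"] r16 by (simp add: small_nonleaders_def of_nat_diff)
  have n10: "int x \<noteq> 6 * int r + 3" using nonl[of "6*r+3"] r16 by (simp add: small_nonleaders_def of_nat_diff)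
  note nonl = n1 n2 n3 n4 n5 n6 n7 n8 n9 n10
  have "int x < \<bar>y\<bar>" if "0 < k" "k < ?m" "[2 ^ k * int x = y] (mod ?n)" for k y
    using that
  proof (induction k arbitrary: y)
    case (Suc k)
    show ?case
    proof (rule ccontr)
      assume "\<not> int x < \<bar>y\<bar>"
      then have yx: "\<bar>y\<bar> \<le> int x" by simp
      have y0: "odd y"
      proof
        assume "even y"
        then obtain z where z: "y = 2 * z" by blast
        then have "[2 * (2 ^ k * int x) = 2 * z] (mod ?n)" using Suc.prems(3) by (simp add: mult.assoc)
        then have zc: "[2 ^ k * int x = z] (mod ?n)"
          by (subst (asm) cong_mult_lcancel) simp_all
        show False
        proof (cases "k = 0")
          case True
          then have "[int x = z] (mod ?n)" using zc by simp
          from cong_abs_ge[OF this, of "int x"] show False using x2 x0 yx z by simp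
        next
          case False
          then have "int x < \<bar>z\<bar>" using Suc.IH[of z] zc Suc.prems(2) by simp
          then show False using yx z by simp
        qed
      qed
      show False
      proof (cases "Suc k \<le> 2 * t + 1")
        case True
        have c: "[2 ^ Suc k * int x = y] (mod (4 * (int r)\<^sup>2 + 1))" using Suc.prems(3) unfolding n .
        have "odd (int x)" "int x \<le> 6 * int r + 4" "\<bar>y\<bar> \<le> 6 * int r + 4" "16 \<le> int r"
          using x yx r16 by auto
        from small_cong_solutions[OF ir this(4) zero_less_Suc True this(1) x0 this(2) y0 this(3) c]
        \<comment> \<open>In every listed solution either y is the larger number, against |y| <= x,
          or x is one of the ten non-leaders.\<close>
        show False by (elim disjE conjE) ((use yx r16 in linarith) | (use nonl in blast))+
      next
        case False
        let ?k = "?m - Suc k"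
        have k: "0 < ?k" "?k \<le> 2 * t + 1" using False Suc.prems by auto
        have "[2 ^ ?k * (2 ^ Suc k * int x) = 2 ^ ?k * y] (mod ?n)"
          by (intro cong_mult cong_refl Suc.prems)
        moreover have "2 ^ ?k * (2 ^ Suc k * int x) = 2 ^ ?m * int x"
        proof -
          have "?k + Suc k = ?m" using Suc.prems(2) by simp
          then have "2 ^ ?m * int x = 2 ^ (?k + Suc k) * int x" by (simp only:)
          then show ?thesis by (simp only: power_add mult.assoc)
        qed
        ultimately have "[2 ^ ?m * int x = 2 ^ ?k * y] (mod ?n)" by (simp only:)
        from cong_trans[OF cong_sym[OF this] pow2_m_cong]
        have "[2 ^ ?k * y = - int x] (mod ?n)" .
        then have c: "[2 ^ ?k * y = - int x] (mod (4 * (int r)\<^sup>2 + 1))" unfolding n .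
        \<comment> \<open>\<open>small_cong_solutions\<close> wants a positive first number, so the
          sign of y is moved to the other side.\<close>
        have c': "[2 ^ ?k * \<bar>y\<bar> = (if 0 \<le> y then - int x else int x)] (mod (4 * (int r)\<^sup>2 + 1))"
          using c cong_minus_minus_iff[of "2 ^ ?k * y" "- int x" "4 * (int r)\<^sup>2 + 1"]
          by (auto simp: abs_if)
        have side: "odd (if 0 \<le> y then - int x else int x)"
          "\<bar>if 0 \<le> y then - int x else int x\<bar> \<le> 6 * int r + 4" "16 \<le> int r"
          "odd \<bar>y\<bar>" "0 < \<bar>y\<bar>" "\<bar>y\<bar> \<le> 6 * int r + 4"
          using x yx r16 y0 by auto
        have abs: "\<bar>if 0 \<le> y then - int x else int x\<bar> = int x" by simp
        from small_cong_solutions[OF ir side(3) k side(4-6) side(1,2) c', unfolded abs]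
        show False by (elim disjE conjE) ((use yx r16 in linarith) | (use nonl in blast))+
      qed
    qed
  qed simp
  then show ?thesis using x0 x2 unfolding strict_leader_def by blast
qed

lemma small_nonleader_reduce:
  assumes t: "t \<ge> 2" and r: "r = 2 ^ (2 * t)" and x: "x \<in> small_nonleaders r"
  shows "\<exists>y. 0 < y \<and> y < x \<and> eqv (4 * t + 2) (int x) (int y)"
proof -
  let ?m = "4 * t + 2" and ?R = "int r"
  have r16: "16 \<le> r" unfolding r by (rule power_2t_ge[OF t])
  have ir: "?R = 2 ^ (2 * t)" by (simp add: r)
  have n: "(2 ^ ?m + 1 :: int) = 4 * ?R\<^sup>2 + 1" unfolding power_m_eq ir ..
  \<comment> \<open>\<open>step1\<close> multiplies by r and \<open>step2\<close> by 2r, with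
    \<open>l\<close> as the quotient modulo 4r^2 + 1. In \<open>e6\<close> and \<open>e7\<close> it
    is the smaller number that is multiplied, and symmetry turns the relation round.\<close>
  have step1: "eqv ?m a b" if "?R * a - b = l * (4 * ?R\<^sup>2 + 1)" for a b l
    unfolding eqv_def n ir[symmetric]
    by (rule exI[of _ "2 * t"]) (use that in \<open>simp add: cong_iff_dvd_diff flip: ir\<close>)
  have step2: "eqv ?m a b" if "2 * ?R * a - b = l * (4 * ?R\<^sup>2 + 1)" for a b l
    unfolding eqv_def n
    by (rule exI[of _ "2 * t + 1"]) (use that in \<open>simp add: cong_iff_dvd_diff flip: ir\<close>)
  have neg: "eqv ?m a (- b) \<Longrightarrow> eqv ?m a b" for a b using eqv_trans eqv_minus by fastforce
  have m: "?m > 0" by simp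
  have e1: "eqv ?m (2*?R+1) (2*?R-1)"
    by (rule step2[where l = 1]) (simp add: power2_eq_square algebra_simps)
  have e2: "eqv ?m (4*?R-3) (3*?R+1)"
    by (rule neg, rule step1[where l = 1]) (simp add: power2_eq_square algebra_simps)
  have e3: "eqv ?m (4*?R-1) (?R+1)"
    by (rule neg, rule step1[where l = 1]) (simp add: power2_eq_square algebra_simps)
  have e4: "eqv ?m (4*?R+1) (?R-1)"
    by (rule step1[where l = 1]) (simp add: power2_eq_square algebra_simps)
  have e5: "eqv ?m (4*?R+3) (3*?R-1)"
    by (rule step1[where l = 1]) (simp add: power2_eq_square algebra_simps)
  have e6: "eqv ?m (5*?R-1) (4*?R+5)"
    by (rule eqv_sym[OF m], rule step1[where l = 1]) (simp add: power2_eq_square algebra_simps)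
  have e7: "eqv ?m (5*?R+1) (4*?R-5)"
    by (rule eqv_sym[OF m], rule neg, rule step1[where l = 1]) (simp add: power2_eq_square algebra_simps)
  have e8: "eqv ?m (6*?R-1) (2*?R+3)"
    by (rule neg, rule step2[where l = 3]) (simp add: power2_eq_square algebra_simps)
  have e9: "eqv ?m (6*?R+1) (2*?R-3)"
    by (rule step2[where l = 3]) (simp add: power2_eq_square algebra_simps)
  have e10: "eqv ?m (6*?R+3) (6*?R-3)"
    by (rule step2[where l = 3]) (simp add: power2_eq_square algebra_simps)
  have red: "\<exists>y. 0 < y \<and> y < x \<and> eqv ?m (int x) (int y)"
    if "int x = a" "eqv ?m a b" "0 < b" "b < a" for a b
    using that by (intro exI[of _ "nat b"]) auto
  from x consider "x = 2*r+1" | "x = 4*r-3" | "x = 4*r-1" | "x = 4*r+1" | "x = 4*r+3" | "x = 5*r-1" | "x = 5*r+1" | "x = 6*r-1" | "x = 6*r+1" | "x = 6*r+3"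
    unfolding small_nonleaders_def by blast
  then show ?thesis
  proof cases
    case 1
    then show ?thesis using r16 by (intro red[OF _ e1]) auto
  next
    case 2
    then show ?thesis using r16 by (intro red[OF _ e2]) auto
  next
    case 3
    then show ?thesis using r16 by (intro red[OF _ e3]) auto
  next
    case 4
    then show ?thesis using r16 by (intro red[OF _ e4]) auto
  next
    case 5
    then show ?thesis using r16 by (intro red[OF _ e5]) auto
  next
    case 6
    then show ?thesis using r16 by (intro red[OF _ e6]) auto
  next
    case 7
    then show ?thesis using r16 by (intro red[OF _ e7]) auto
  next
    case 8
    then show ?thesis using r16 by (intro red[OF _ e8]) auto
  next
    case 9
    then show ?thesis using r16 by (intro red[OF _ e9]) auto
  next
    case 10
    then show ?thesis using r16 by (intro red[OF _ e10]) auto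
  qed
qed

section \<open>Counting the leaders below a small bound\<close>

lemma card_odd_less:
  assumes "odd \<delta>"
  shows "card {x::nat. odd x \<and> x < \<delta>} = (\<delta> - 1) div 2"
proof -
  have "{x. odd x \<and> x < \<delta>} = (\<lambda>i. 2 * i + 1) ` {..<(\<delta> - 1) div 2}"
  proof (intro equalityI subsetI)
    fix x assume x: "x \<in> {x. odd x \<and> x < \<delta>}"
    then obtain i where i: "x = 2 * i + 1" by (auto elim: oddE)
    from assms obtain d where d: "\<delta> = 2 * d + 1" by (auto elim: oddE)
    show "x \<in> (\<lambda>i. 2 * i + 1) ` {..<(\<delta> - 1) div 2}" using x unfolding i d by auto
  next
    fix x assume "x \<in> (\<lambda>i. 2 * i + 1) ` {..<(\<delta> - 1) div 2}"
    then show "x \<in> {x. odd x \<and> x < \<delta>}" using assms by (auto elim!: oddE)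
  qed
  then show ?thesis by (simp add: card_image inj_on_def)
qed

lemma card_cosets_below_small:
  assumes t: "t \<ge> 2" and r: "r = 2 ^ (2 * t)" and \<delta>: "odd \<delta>" "\<delta> \<le> 6 * r + 5"
  shows "card (cosets_below (4 * t + 2) \<delta>)
    = 2 * (4 * t + 2) * ((\<delta> - 1) div 2 - card {x \<in> small_nonleaders r. x < \<delta>})"
proof -
  define L where "L = {x. odd x \<and> x < \<delta>} - small_nonleaders r"
  have r16: "16 \<le> r" unfolding r by (rule power_2t_ge[OF t])
  have "even r" unfolding r using t by simp
  have "card (cosets_below (4 * t + 2) \<delta>) = 2 * (4 * t + 2) * card L"
  proof (rule card_cosets_below)
    show "L \<subseteq> {1..<\<delta>}" unfolding L_def by (auto simp: Suc_le_eq intro: odd_pos)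
    show "strict_leader (4 * t + 2) (int x)" if "x \<in> L" for x
      using that \<delta>(2) by (intro small_strict_leader[OF t r]) (auto simp: L_def)
    show "\<exists>y. 0 < y \<and> y < x \<and> eqv (4 * t + 2) (int x) (int y)" if x: "x \<in> {1..<\<delta>} - L" for x
    proof (cases "even x")
      case True
      then obtain y where y: "x = 2 * y" by blast
      have "eqv (4 * t + 2) (int y) (int x)" unfolding eqv_def by (rule exI[of _ 1]) (simp add: y)
      then have "eqv (4 * t + 2) (int x) (int y)" by (rule eqv_sym[rotated]) simp
      then show ?thesis using x y by (intro exI[of _ y]) auto
    next
      case False
      then show ?thesis using x by (intro small_nonleader_reduce[OF t r]) (auto simp: L_def)
    qed
  qed simp
  also have "card L = card {x. odd x \<and> x < \<delta>} - card {x \<in> small_nonleaders r. x < \<delta>}"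
  proof -
    have "L = {x. odd x \<and> x < \<delta>} - {x \<in> small_nonleaders r. x < \<delta>}" unfolding L_def by auto
    moreover have "{x \<in> small_nonleaders r. x < \<delta>} \<subseteq> {x. odd x \<and> x < \<delta>}"
    proof -
      have "odd x" if "x \<in> small_nonleaders r" for x
      proof -
        from \<open>even r\<close> obtain r' where "r = 2 * r'" by blast
        then show ?thesis using that r16 unfolding small_nonleaders_def
          by (elim insertE emptyE) simp_all
      qed
      then show ?thesis by blast
    qed
    moreover have "finite {x \<in> small_nonleaders r. x < \<delta>}" by (simp add: small_nonleaders_def)
    ultimately show ?thesis by (simp add: card_Diff_subset)
  qed
  finally show ?thesis by (simp add: card_odd_less[OF \<delta>(1)])
qed

lemma card_filter_insert:
  assumes "finite A" "a \<notin> A"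
  shows "card {x \<in> insert a A. P x} = (if P a then 1 else 0) + card {x \<in> A. P x}"
proof (cases "P a")
  case True
  then have "{x \<in> insert a A. P x} = insert a {x \<in> A. P x}" by auto
  then show ?thesis using True assms by simp
next
  case False
  then have "{x \<in> insert a A. P x} = {x \<in> A. P x}" by auto
  then show ?thesis using False by simp
qed

lemma card_small_nonleaders_below:
  assumes r: "16 \<le> r"
  shows "card {x \<in> small_nonleaders r. x < \<delta>} =
    (if 2*r+1 < \<delta> then 1 else 0) + (if 4*r-3 < \<delta> then 1 else 0) + (if 4*r-1 < \<delta> then 1 else 0) +
    (if 4*r+1 < \<delta> then 1 else 0) + (if 4*r+3 < \<delta> then 1 else 0) + (if 5*r-1 < \<delta> then 1 else 0) +
    (if 5*r+1 < \<delta> then 1 else 0) + (if 6*r-1 < \<delta> then 1 else 0) + (if 6*r+1 < \<delta> then 1 else 0) +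
    (if 6*r+3 < \<delta> then 1 else 0)"
proof -
  \<comment> \<open>The shift by 16 removes the truncated subtractions and makes the ten elements
    visibly distinct.\<close>
  from r obtain s where s: "r = 16 + s" using le_Suc_ex by blast
  show ?thesis unfolding small_nonleaders_def s by (subst card_filter_insert, simp, simp)+ simp
qed

section \<open>The largest coset leaders\<close>

lemma leader_le_half:
  assumes "leader m x"
  shows "2 * x \<le> 2 ^ m + 1"
proof -
  have "eqv m x (x - (2 ^ m + 1))" by (rule eqv_cong) (simp add: cong_iff_dvd_diff)
  then have "x \<le> \<bar>x - (2 ^ m + 1)\<bar>" using assms by (auto simp: leader_def)
  moreover have "0 < (2::int) ^ m" by simp
  ultimately show ?thesis by linarith
qed

lemma leader_cong_le:
  assumes "leader m x" "eqv m x y" "[2 ^ k * y = z] (mod (2 ^ m + 1))"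
  shows "x \<le> \<bar>z\<bar>"
proof -
  have "eqv m y z" unfolding eqv_def using assms(3) by blast
  then show ?thesis using assms(1) eqv_trans[OF assms(2)] by (auto simp: leader_def)
qed

text \<open>An orbit avoiding $[-N, N]$ would stay in $[3N/2, 2N]$ up to sign, where the map
  $y \mapsto 5N - 2y$ is expanding about its fixed point $5N/3$.\<close>

lemma leader_le_fifth:
  fixes N :: int
  assumes n: "2 ^ m + 1 = 5 * N" and "even m" and x: "leader m x"
  shows "x \<le> N"
proof (rule ccontr)
  assume "\<not> x \<le> N"
  then have xN: "N < x" by simp
  have N0: "0 < N"
  proof -
    have "0 < (2::int) ^ m + 1" by (simp add: add_pos_pos)
    then show ?thesis using n by simp
  qed
  have window: "3 * N \<le> 2 * y \<and> y \<le> 2 * N" if y: "eqv m x y" "0 < y" "2 * y \<le> 5 * N" for y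
  proof (rule ccontr)
    assume out: "\<not> (3 * N \<le> 2 * y \<and> y \<le> 2 * N)"
    have "x \<le> \<bar>y\<bar>" using x y by (auto simp: leader_def)
    \<comment> \<open>Points above 2N are sent into (-N, N) by one doubling, points between N and
      3N/2 by two.\<close>
    have "x \<le> \<bar>2 * y - 5 * N\<bar>"
      by (rule leader_cong_le[OF x y(1), of 1]) (simp add: n cong_iff_dvd_diff)
    moreover have "x \<le> \<bar>4 * y - 5 * N\<bar>"
      by (rule leader_cong_le[OF x y(1), of 2]) (simp add: n cong_iff_dvd_diff)
    ultimately show False using out xN y \<open>x \<le> \<bar>y\<bar>\<close> by linarith
  qed
  have orbit: "\<exists>y. eqv m x y \<and> 0 < y \<and> 2 * y \<le> 5 * N \<and> 3 * y - 5 * N = (-2) ^ k * (3 * x - 5 * N)" for k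
  proof (induction k)
    case 0
    show ?case using eqv_refl x leader_le_half[OF x] by (auto simp: n leader_def)
  next
    case (Suc k)
    then obtain y where y: "eqv m x y" "0 < y" "2 * y \<le> 5 * N"
      "3 * y - 5 * N = (-2) ^ k * (3 * x - 5 * N)" by blast
    have "eqv m y (2 * y - 5 * N)"
      unfolding eqv_def by (rule exI[of _ 1]) (simp add: n cong_iff_dvd_diff)
    then have "eqv m x (- (2 * y - 5 * N))" using eqv_trans[OF y(1)] eqv_minus eqv_trans by blast
    moreover have "3 * (- (2 * y - 5 * N)) - 5 * N = (-2) * (3 * y - 5 * N)" by simp
    moreover have "0 < - (2 * y - 5 * N)" "2 * - (2 * y - 5 * N) \<le> 5 * N"
      using window[OF y(1-3)] N0 by simp_all
    ultimately show ?case using y(4) by (intro exI[of _ "- (2 * y - 5 * N)"]) simp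
  qed
  \<comment> \<open>The fixed point is the one start that is never driven out of the window. It is
    excluded because 2^m + 1 is 2 modulo 3 for even m.\<close>
  have "3 * x \<noteq> 5 * N"
  proof
    assume "3 * x = 5 * N"
    then have "(3::int) dvd 2 ^ m + 1" unfolding n by (metis dvd_triv_left)
    moreover from \<open>even m\<close> obtain h where h: "m = 2 * h" by blast
    have "[4 ^ h + 1 = 1 ^ h + 1] (mod (3::int))"
      by (intro cong_add cong_refl cong_pow) (simp add: cong_def)
    then have "(2 ^ m + 1) mod 3 = (2::int)" unfolding h by (simp add: power_mult cong_def)
    ultimately show False by presburger
  qed
  then have ge: "2 ^ k \<le> \<bar>(-2) ^ k * (3 * x - 5 * N)\<bar>" for k
    by (simp add: abs_mult power_abs)
  \<comment> \<open>Any step count k with 2^k > N would do: inside the window |3y - 5N| is at most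
    N, and the displacement has grown to at least 2^k.\<close>
  from orbit[of "nat N"] obtain y where y: "eqv m x y" "0 < y" "2 * y \<le> 5 * N"
    "3 * y - 5 * N = (-2) ^ nat N * (3 * x - 5 * N)" by blast
  have "2 ^ nat N \<le> \<bar>3 * y - 5 * N\<bar>" unfolding y(4) by (rule ge)
  also have "\<dots> \<le> N" using window[OF y(1-3)] by linarith
  finally have "2 ^ nat N \<le> N" .
  moreover have "nat N < 2 ^ nat N" by (rule less_exp)
  then have "int (nat N) < int (2 ^ nat N)" by (simp only: of_nat_less_iff)
  ultimately show False using N0 by simp
qed

lemma cong_mod_5N_16:
  fixes N :: int
  shows "[16 ^ i * N = N] (mod 5 * N)"
proof (induction i)
  case (Suc i)
  have "[16 * (16 ^ i * N) = 16 * N] (mod 5 * N)" by (intro cong_mult cong_refl Suc)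
  also have "[16 * N = N] (mod 5 * N)" by (simp add: cong_iff_dvd_diff)
  finally show ?case by (simp add: mult.assoc)
qed simp

text \<open>If the whole orbit of $x = N - e$ has absolute value at least $7N/8$, then multiplication
  by 16 maps $\pm(N-e)$ to $\pm(N-e')$ with $0 < e' \le N/8$; since $m \equiv 2 \pmod 4$, after
  $m$ doublings one would instead arrive at $\pm(N+4e')$.\<close>

lemma leader_ge_seven_eighths:
  fixes N x :: int
  assumes n: "2 ^ (4 * t + 2) + 1 = 5 * N" and x: "leader (4 * t + 2) x" and ge: "7 * N \<le> 8 * x"
  shows "x = N"
proof (rule ccontr)
  assume "x \<noteq> N"
  let ?m = "4 * t + 2"
  have "odd N" using arg_cong[OF n, of even] by simp
  have xN: "x < N" using leader_le_fifth[OF n _ x] \<open>x \<noteq> N\<close> by simp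
  have "\<exists>e s. 0 < e \<and> 8 * e \<le> N \<and> (s = 1 \<or> s = -1) \<and> [16 ^ i * x = s * (N - e)] (mod 5 * N)" for i
  proof (induction i)
    case 0
    show ?case using xN ge by (intro exI[of _ "N - x"] exI[of _ 1]) simp
  next
    case (Suc i)
    then obtain e s where e: "0 < e" "8 * e \<le> N" and s: "s = 1 \<or> s = -1"
      and c: "[16 ^ i * x = s * (N - e)] (mod 5 * N)" by blast
    have "[16 * (16 ^ i * x) = 16 * (s * (N - e))] (mod 5 * N)" by (intro cong_mult cong_refl c)
    also have "16 * (s * (N - e)) = s * (N - 16 * e) + 5 * N * (3 * s)" by (simp add: algebra_simps)
    also have "[s * (N - 16 * e) + 5 * N * (3 * s) = s * (N - 16 * e)] (mod 5 * N)"
      by (simp add: cong_iff_dvd_diff)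
    finally have c': "[16 ^ Suc i * x = s * (N - 16 * e)] (mod 5 * N)" by (simp add: mult.assoc)
    have "(2::int) ^ (4 * Suc i) = 16 ^ Suc i" unfolding power_mult by simp
    then have "x \<le> \<bar>s * (N - 16 * e)\<bar>"
      using leader_cong_le[OF x eqv_refl, of "4 * Suc i"] c' n by simp
    \<comment> \<open>Since |N - 16e| is at least 7N/8, either 16e is at most N/8, or it is at least
      15N/8. In the second case the point lies near -N, at distance 2N - 16e.\<close>
    then have big: "x \<le> \<bar>N - 16 * e\<bar>" using s by (auto simp: abs_mult)
    show ?case
    proof (cases "16 * e \<le> N")
      case True
      then have "8 * (16 * e) \<le> N" using big ge by linarith
      then show ?thesis using c' e s by (intro exI[of _ "16 * e"] exI[of _ s]) auto
    next
      case False
      have "2 * N - 16 * e \<noteq> 0"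
      proof
        assume "2 * N - 16 * e = 0"
        then have "N = 2 * (4 * e)" by simp
        then show False using \<open>odd N\<close> by (metis dvd_triv_left)
      qed
      then have "0 < 2 * N - 16 * e" using e by linarith
      moreover have "16 * N - 128 * e \<le> N" using False big ge by linarith
      then have "8 * (2 * N - 16 * e) \<le> N" by simp
      moreover have "s * (N - 16 * e) = (- s) * (N - (2 * N - 16 * e))" by (simp add: algebra_simps)
      ultimately show ?thesis using c' s
        by (intro exI[of _ "2 * N - 16 * e"] exI[of _ "- s"]) auto
    qed
  qed
  from this[of t] obtain e s where e: "0 < e" "8 * e \<le> N" and s: "s = 1 \<or> s = -1"
    and c: "[16 ^ t * x = s * (N - e)] (mod 5 * N)" by blast
  have "[4 * (16 ^ t * x) = 4 * (s * (N - e))] (mod 5 * N)" by (intro cong_mult cong_refl c)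
  moreover have "(4::int) * (16 ^ t * x) = 2 ^ ?m * x"
    by (simp add: power_add power_mult)
  moreover have "[2 ^ ?m * x = - x] (mod 5 * N)" using pow2_m_cong[of ?m x] n by simp
  ultimately have "[- x = 4 * (s * (N - e))] (mod 5 * N)" using cong_sym cong_trans by metis
  then have d: "5 * N dvd - x - 4 * (s * (N - e))" by (simp add: cong_iff_dvd_diff)
  from s show False
  proof
    assume "s = 1"
    have "5 * N dvd (- x - 4 * (s * (N - e))) + 5 * N" by (intro dvd_add d) simp
    also have "(- x - 4 * (s * (N - e))) + 5 * N = N + 4 * e - x" using \<open>s = 1\<close> by simp
    finally have "5 * N dvd N + 4 * e - x" .
    then have "5 * N \<le> N + 4 * e - x" using e xN by (intro zdvd_imp_le) auto
    then show False using e xN ge by linarith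
  next
    assume "s = -1"
    have "5 * N dvd 5 * N - (- x - 4 * (s * (N - e)))" by (intro dvd_diff d) simp
    also have "5 * N - (- x - 4 * (s * (N - e))) = N + 4 * e + x" using \<open>s = -1\<close> by simp
    finally have "5 * N dvd N + 4 * e + x" .
    then have "5 * N \<le> N + 4 * e + x" using e xN ge by (intro zdvd_imp_le) auto
    then show False using e xN ge by linarith
  qed
qed

text \<open>From here on $x = \delta_2 - j$, that is $8x = 7N - 3 - 8j$.\<close>

lemma cong_64_power16:
  fixes N x j :: int
  assumes "8 * x = 7 * N - 3 - 8 * j"
  shows "[2 ^ (6 + 4 * i) * x = N - 16 ^ i * (64 * j + 24)] (mod 5 * N)"
proof -
  have "(2::int) ^ (6 + 4 * i) * x = 16 ^ i * (8 * (8 * x))"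
    by (simp add: power_add power_mult)
  \<comment> \<open>8(8x) = 56N - (64j + 24), and 56 = 1 + 5 * 11. So six doublings bring x back
    close to N, after which blocks of four multiply the deviation by 16.\<close>
  also have "\<dots> = 16 ^ i * N - 16 ^ i * (64 * j + 24) + 5 * N * (11 * 16 ^ i)"
    unfolding assms by (simp add: algebra_simps)
  also have "[\<dots> = 16 ^ i * N - 16 ^ i * (64 * j + 24)] (mod 5 * N)"
    by (simp add: cong_iff_dvd_diff)
  also have "[16 ^ i * N - 16 ^ i * (64 * j + 24) = N - 16 ^ i * (64 * j + 24)] (mod 5 * N)"
    by (intro cong_diff cong_mod_5N_16 cong_refl)
  finally show ?thesis .
qed

text \<open>Here N is about 3277P and x about 2867P, so a deviation of the order of several hundred
  P up to about 6000P leads to a smaller member of the orbit. For 1 <= j <= 5 this happens in block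
  t - 2, for 7 <= j <= 94 in block t - 3. For 97 <= j <= 100 it happens in block t - 2 once 6 * 5N
  is added. The values 0, 6 and 96 just escape.\<close>

lemma leader_near_delta2:
  fixes N x j :: int
  assumes n: "2 ^ (4 * t + 2) + 1 = 5 * N" and t: "t \<ge> 3" and x: "leader (4 * t + 2) x"
    and j: "8 * x = 7 * N - 3 - 8 * j" "0 \<le> j" "j \<le> 100"
  shows "j = 0 \<or> j = 6 \<or> j = 96"
proof (rule ccontr)
  assume nj: "\<not> ?thesis"
  define P :: int where "P = 16 ^ (t - 3)"
  have P1: "1 \<le> P" by (simp add: P_def)
  have P2: "16 ^ (t - 2) = 16 * P"
  proof -
    have "t - 2 = Suc (t - 3)" using t by simp
    then show ?thesis by (simp add: P_def)
  qed
  have "4 * t + 2 = 4 * (t - 3) + 14" using t by simp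
  then have "(2::int) ^ (4 * t + 2) = 2 ^ 14 * P" by (simp only: power_add power_mult) (simp add: P_def)
  then have NP: "5 * N = 16384 * P + 1" using n by simp
  have ge: "x \<le> \<bar>N - 16 ^ i * (64 * j + 24) + 5 * N * l\<bar>" for i l
  proof (rule leader_cong_le[OF x eqv_refl, of "6 + 4 * i"])
    have "[N - 16 ^ i * (64 * j + 24) = N - 16 ^ i * (64 * j + 24) + 5 * N * l] (mod 5 * N)"
      by (simp add: cong_iff_dvd_diff)
    then show "[2 ^ (6 + 4 * i) * x = N - 16 ^ i * (64 * j + 24) + 5 * N * l] (mod 2 ^ (4 * t + 2) + 1)"
      unfolding n using cong_64_power16[OF j(1)] cong_trans by blast
  qed
  have "even j"
  proof -
    have "odd x" using leader_odd[OF _ x] by simp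
    \<comment> \<open>This displays delta_2 = x + j, which is (14336P - 1)/5, as an odd number
      without a division; the coefficients come from 5N = 16384P + 1.\<close>
    moreover have "j = 2 * (93184 * P - 28 * N + 5) + 1 - x" using NP j(1) by (simp add: algebra_simps)
    ultimately show ?thesis by simp
  qed
  have bounds: "P * a \<le> P * j" "P * j \<le> P * b" if "a \<le> j" "j \<le> b" for a b
    using that P1 by (auto intro: mult_left_mono)
  have "j \<noteq> 95" using \<open>even j\<close> by auto
  then consider "1 \<le> j" "j \<le> 5" | "7 \<le> j" "j \<le> 94" | "97 \<le> j" "j \<le> 100"
    using nj j by linarith
  then show False
  proof cases
    case 1
    have "x \<le> \<bar>N - (384 * P + 1024 * (P * j))\<bar>"
      using ge[of "t - 2" 0] by (simp add: P2 algebra_simps)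
    then show False using bounds[OF 1] NP P1 j by linarith
  next
    case 2
    have "x \<le> \<bar>N - (24 * P + 64 * (P * j))\<bar>"
      using ge[of "t - 3" 0] by (simp add: algebra_simps flip: P_def)
    moreover have "1 * j \<le> P * j" using P1 j(2) by (intro mult_right_mono)
    ultimately show False using bounds[OF 2] 2 NP P1 j by linarith
  next
    case 3
    have "x \<le> \<bar>31 * N - (384 * P + 1024 * (P * j))\<bar>"
      using ge[of "t - 2" 6] by (simp add: P2 algebra_simps)
    then show False using bounds[OF 3] NP P1 j by linarith
  qed
qed

section \<open>Strict leaders near delta_2 for t > 2\<close>

text \<open>Within a block, the doublings of N - e are 2N - 2e, -N - 4e and -2N - 8e modulo 5N. With
  e < N/4 none of them is smaller than x in absolute value, so only the start of each block has to
  be examined.\<close>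

lemma block_gt:
  fixes N e x y s :: int
  assumes e: "0 \<le> e" "e < N - x" and x: "3 * N \<le> 4 * x" and s: "s = 1 \<or> s = -1"
    and h: "h < 4" and c: "[2 ^ h * (s * (N - e)) = y] (mod 5 * N)"
  shows "x < \<bar>y\<bar>"
proof -
  have gt: "x < \<bar>y\<bar>" if "2 ^ h * (N - e) = z + 5 * N * l" "\<bar>z\<bar> + x < 5 * N" "x < \<bar>z\<bar>" for z l
  proof -
    have "2 ^ h * (s * (N - e)) = s * z + 5 * N * (s * l)"
      using arg_cong[OF that(1), of "\<lambda>a. s * a"] by (simp add: algebra_simps)
    then have "[s * z + 5 * N * (s * l) = y] (mod 5 * N)" using c by simp
    moreover have "[s * z = s * z + 5 * N * (s * l)] (mod 5 * N)" by (simp add: cong_iff_dvd_diff)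
    ultimately have "[s * z = y] (mod 5 * N)" using cong_trans by blast
    moreover have "\<bar>s * z\<bar> = \<bar>z\<bar>" using s by (auto simp: abs_mult)
    ultimately show ?thesis using cong_abs_gt[of "s * z" y "5 * N" x] that by simp
  qed
  consider "h = 0" | "h = 1" | "h = 2" | "h = 3" using h by linarith
  then show ?thesis
  proof cases
    case 1
    show ?thesis by (rule gt[of "N - e" 0]) (use 1 e x in auto)
  next
    case 2
    show ?thesis by (rule gt[of "2 * N - 2 * e" 0]) (use 2 e x in auto)
  next
    case 3
    show ?thesis by (rule gt[of "- N - 4 * e" 1]) (use 3 e x in auto)
  next
    case 4
    show ?thesis by (rule gt[of "- 2 * N - 8 * e" 2]) (use 4 e x in auto)
  qed
qed

text \<open>The first five doublings stay clear of x by explicit representatives; N >= 3000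
  dominates the terms in j there. From the sixth on, exponents are 6 + 4i + h with h < 4, and k < 4t
  + 2 means i + 2 <= t.\<close>

lemma strict_leader_near_delta2:
  fixes N x j :: int
  assumes n: "2 ^ (4 * t + 2) + 1 = 5 * N" and N: "3000 \<le> N"
    and j: "8 * x = 7 * N - 3 - 8 * j" "0 \<le> j" "j \<le> 100"
    and blocks: "\<And>i. i + 2 \<le> t \<Longrightarrow>
      \<exists>e s. 0 \<le> e \<and> e < N - x \<and> (s = 1 \<or> s = -1) \<and>
        [N - 16 ^ i * (64 * j + 24) = s * (N - e)] (mod 5 * N)"
  shows "strict_leader (4 * t + 2) x"
  unfolding strict_leader_def
proof (intro conjI allI impI)
  show "0 < x" using j N by linarith
  show "2 * x < 2 ^ (4 * t + 2) + 1" unfolding n using j N by linarith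
  fix k y assume "0 < k \<and> k < 4 * t + 2 \<and> [2 ^ k * x = y] (mod 2 ^ (4 * t + 2) + 1)"
  then have k: "0 < k" "k < 4 * t + 2" and c: "[2 ^ k * x = y] (mod 5 * N)"
    unfolding n by blast+
  have x34: "3 * N \<le> 4 * x" using j N by linarith
  have gt: "x < \<bar>y\<bar>" if "2 ^ k * x = z + 5 * N * l" "\<bar>z\<bar> + x < 5 * N" "x < \<bar>z\<bar>" for z l
  proof -
    have "[z + 5 * N * l = y] (mod 5 * N)" using c that(1) by simp
    moreover have "[z = z + 5 * N * l] (mod 5 * N)" by (simp add: cong_iff_dvd_diff)
    ultimately have "[z = y] (mod 5 * N)" using cong_trans by blast
    then show ?thesis using cong_abs_gt that by blast
  qed
  consider "k = 1" | "k = 2" | "k = 3" | "k = 4" | "k = 5" | "6 \<le> k" using k by linarith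
  then show "x < \<bar>y\<bar>"
  proof cases
    case 1
    show ?thesis by (rule gt[of "2 * x" 0]) (use 1 N j in auto)
  next
    case 2
    show ?thesis by (rule gt[of "4 * x - 5 * N" 1]) (use 2 N j in auto)
  next
    case 3
    show ?thesis by (rule gt[of "2 * N - 3 - 8 * j" 1]) (use 3 N j in auto)
  next
    case 4
    show ?thesis by (rule gt[of "- N - 6 - 16 * j" 3]) (use 4 N j in auto)
  next
    case 5
    show ?thesis by (rule gt[of "- 2 * N - 12 - 32 * j" 6]) (use 5 N j in auto)
  next
    case 6
    define i h where "i = (k - 6) div 4" and "h = (k - 6) mod 4"
    have kih: "k = h + (6 + 4 * i)" and h4: "h < 4" using 6 by (auto simp: i_def h_def)
    then have "i + 2 \<le> t" using k(2) by linarith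
    from blocks[OF this] obtain e s where e: "0 \<le> e" "e < N - x" and s: "s = 1 \<or> s = -1"
      and c': "[N - 16 ^ i * (64 * j + 24) = s * (N - e)] (mod 5 * N)" by blast
    have "[2 ^ (6 + 4 * i) * x = s * (N - e)] (mod 5 * N)"
      using cong_trans[OF cong_64_power16[OF j(1)] c'] .
    then have "[2 ^ h * (2 ^ (6 + 4 * i) * x) = 2 ^ h * (s * (N - e))] (mod 5 * N)"
      by (rule cong_scalar_left)
    moreover have "2 ^ h * (2 ^ (6 + 4 * i) * x) = 2 ^ k * x"
      unfolding kih by (simp only: power_add mult.assoc)
    ultimately have "[2 ^ h * (s * (N - e)) = y] (mod 5 * N)"
      using c by (metis cong_sym cong_trans)
    then show ?thesis using block_gt[OF e x34 s h4] by blast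
  qed
qed

text \<open>A deviation 16^i (64j + 24) below N - x, about N/8, needs no reduction. Otherwise it
  turns out to be close to an even multiple of N: 16 * 408 P and 6168P are just below 2N, and 16 *
  6168 P is just above 30N. Such an orbit returns close to N or -N, which is what singles out j = 6
  and j = 96.\<close>

lemma strict_leaders_near_delta2:
  fixes N x j :: int
  assumes n: "2 ^ (4 * t + 2) + 1 = 5 * N" and t: "t \<ge> 3"
    and j: "8 * x = 7 * N - 3 - 8 * j" "j = 0 \<or> j = 6 \<or> j = 96"
  shows "strict_leader (4 * t + 2) x"
proof -
  define P :: int where "P = 16 ^ (t - 3)"
  have P1: "1 \<le> P" by (simp add: P_def)
  have P2: "16 ^ (t - 2) = 16 * P"
  proof -
    have "t - 2 = Suc (t - 3)" using t by simp
    then show ?thesis by (simp add: P_def)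
  qed
  have "4 * t + 2 = 4 * (t - 3) + 14" using t by simp
  then have "(2::int) ^ (4 * t + 2) = 2 ^ 14 * P" by (simp only: power_add power_mult) (simp add: P_def)
  then have NP: "5 * N = 16384 * P + 1" using n by simp
  have mono: "(16::int) ^ i \<le> 16 ^ k" if "i \<le> k" for i k using that by (intro power_increasing) auto
  show ?thesis
  proof (rule strict_leader_near_delta2[OF n _ j(1)])
    show "3000 \<le> N" using NP P1 by linarith
    show "0 \<le> j" "j \<le> 100" using j(2) by auto
    fix i assume i: "i + 2 \<le> t"
    let ?P = "\<exists>e s. 0 \<le> e \<and> e < N - x \<and> (s = 1 \<or> s = -1) \<and>
        [N - 16 ^ i * (64 * j + 24) = s * (N - e)] (mod 5 * N)"
    have direct: ?P if "16 ^ i * (64 * j + 24) < N - x"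
      using that j(2) by (intro exI[of _ "16 ^ i * (64 * j + 24)"] exI[of _ 1]) auto
    from j(2) show ?P
    proof (elim disjE)
      assume j0: "j = 0"
      have "(16::int) ^ i \<le> 16 ^ (t - 2)" using i by (intro mono) simp
      then have "16 ^ i * (64 * j + 24) < N - x" using P2 NP P1 j(1) unfolding j0 by simp
      then show ?P by (rule direct)
    next
      assume j6: "j = 6"
      show ?P
      proof (cases "i = t - 2")
        case True
        then have p: "16 ^ i = 16 * P" using P2 by simp
        have "[N - 16 ^ i * (64 * j + 24) = - 1 * (N - (2 * N - 6528 * P))] (mod 5 * N)"
          unfolding p j6 by simp
        moreover have "0 \<le> 2 * N - 6528 * P" "2 * N - 6528 * P < N - x"
          using NP P1 j(1) j6 by linarith+
        ultimately show ?P by blast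
      next
        case False
        then have "(16::int) ^ i \<le> P" unfolding P_def using i by (intro mono) simp
        then have "16 ^ i * (64 * j + 24) < N - x" using NP P1 j(1) unfolding j6 by simp
        then show ?P by (rule direct)
      qed
    next
      assume j96: "j = 96"
      consider "i = t - 2" | "i = t - 3" | "i + 4 \<le> t" using i t by linarith
      then show ?P
      proof cases
        case 1
        then have p: "16 ^ i = 16 * P" using P2 by simp
        have "[N - 16 ^ i * (64 * j + 24) = 1 * (N - (98688 * P - 30 * N))] (mod 5 * N)"
          unfolding p j96 by (simp add: cong_iff_dvd_diff)
        moreover have "0 \<le> 98688 * P - 30 * N" "98688 * P - 30 * N < N - x"
          using NP P1 j(1) j96 by linarith+
        ultimately show ?P by blast
      next
        case 2
        then have p: "16 ^ i = P" by (simp add: P_def)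
        have "[N - 16 ^ i * (64 * j + 24) = - 1 * (N - (2 * N - 6168 * P))] (mod 5 * N)"
          unfolding p j96 by (simp add: mult.commute)
        moreover have "0 \<le> 2 * N - 6168 * P" "2 * N - 6168 * P < N - x"
          using NP P1 j(1) j96 by linarith+
        ultimately show ?P by blast
      next
        case 3
        \<comment> \<open>6168/16 is 385.5, which is still below N - x, about 410P; this is why only
          the last two blocks are special.\<close>
        then have "(16::int) ^ Suc i \<le> P" unfolding P_def by (intro mono) simp
        then have "16 ^ i * (64 * j + 24) < N - x" using NP P1 j(1) unfolding j96 by simp
        then show ?P by (rule direct)
      qed
    qed
  qed
qed

text \<open>For $t = 2$ the pattern of the exceptional $j$ is different; this case is a finite computation.\<close>

definition check_strict :: "nat \<Rightarrow> nat \<Rightarrow> nat \<Rightarrow> bool" where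
  "check_strict m n x \<longleftrightarrow> list_all (\<lambda>k. let y = 2 ^ k * x mod n in x < y \<and> y + x < n) [1..<m]"

definition check_nonleader :: "nat \<Rightarrow> nat \<Rightarrow> nat \<Rightarrow> bool" where
  "check_nonleader m n x \<longleftrightarrow> list_ex (\<lambda>k. let y = 2 ^ k * x mod n in y < x \<or> n - y < x) [1..<m]"

lemma check_strict_sound:
  assumes "check_strict m (2 ^ m + 1) x" "0 < x" "2 * x < 2 ^ m + 1"
  shows "strict_leader m (int x)"
  unfolding strict_leader_def
proof (intro conjI allI impI)
  show "0 < int x" using assms by simp
  have "int (2 * x) < int (2 ^ m + 1)" using assms(3) by (simp only: of_nat_less_iff)
  then show "2 * int x < 2 ^ m + 1" by simp
  fix k y assume k: "0 < k \<and> k < m \<and> [2 ^ k * int x = y] (mod 2 ^ m + 1)"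
  define z where "z = 2 ^ k * x mod (2 ^ m + 1)"
  have z: "x < z" "z + x < 2 ^ m + 1"
    using assms(1) k unfolding check_strict_def z_def list_all_iff Let_def by auto
  have "[2 ^ k * x = z] (mod (2 ^ m + 1))" by (simp add: z_def cong_def)
  then have "[int (2 ^ k * x) = int z] (mod int (2 ^ m + 1))" by (simp only: cong_int_iff)
  then have "[2 ^ k * int x = int z] (mod (2 ^ m + 1))" by (simp add: add.commute)
  then have c: "[int z = y] (mod (2 ^ m + 1))" using k cong_sym cong_trans by blast
  have "int (z + x) < int (2 ^ m + 1)" using z(2) by (simp only: of_nat_less_iff)
  then show "int x < \<bar>y\<bar>" using cong_abs_gt[OF c, of "int x"] z(1) by simp
qed

lemma check_nonleader_sound:
  assumes "check_nonleader m (2 ^ m + 1) x"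
  shows "\<not> leader m (int x)"
proof
  assume l: "leader m (int x)"
  from assms obtain k where k: "2 ^ k * x mod (2 ^ m + 1) < x \<or> 2 ^ m + 1 - 2 ^ k * x mod (2 ^ m + 1) < x"
    unfolding check_nonleader_def list_ex_iff Let_def by blast
  define z where "z = 2 ^ k * x mod (2 ^ m + 1)"
  have zn: "z < 2 ^ m + 1" by (simp add: z_def)
  have "[2 ^ k * x = z] (mod (2 ^ m + 1))" by (simp add: z_def cong_def)
  then have "[int (2 ^ k * x) = int z] (mod int (2 ^ m + 1))" by (simp only: cong_int_iff)
  then have c: "[2 ^ k * int x = int z] (mod (2 ^ m + 1))" by (simp add: add.commute)
  have "int x \<le> \<bar>int z\<bar>" by (rule leader_cong_le[OF l eqv_refl c])
  moreover have "int x \<le> \<bar>int z - (2 ^ m + 1)\<bar>"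
  proof (rule leader_cong_le[OF l eqv_refl])
    have "[int z = int z - (2 ^ m + 1)] (mod (2 ^ m + 1))" by (simp add: cong_iff_dvd_diff)
    then show "[2 ^ k * int x = int z - (2 ^ m + 1)] (mod (2 ^ m + 1))" using c cong_trans by blast
  qed
  moreover have "int z < int (2 ^ m + 1)" using zn by (simp only: of_nat_less_iff)
  then have "\<bar>int z - (2 ^ m + 1)\<bar> = int (2 ^ m + 1 - z)" using zn by (simp add: of_nat_diff)
  ultimately show False using k unfolding z_def[symmetric] by auto
qed

text \<open>For m = 10 the values 179, 173, 171 and 155 are delta_2 to delta_5, so the search covers
  everything above delta_5 up to delta_2.\<close>

lemma leaders_2:
  "strict_leader 10 179" "strict_leader 10 173" "strict_leader 10 171"
  "leader 10 x \<Longrightarrow> 156 \<le> x \<Longrightarrow> x \<le> 179 \<Longrightarrow> x = 179 \<or> x = 173 \<or> x = 171"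
proof -
  have "check_strict 10 1025 179" "check_strict 10 1025 173" "check_strict 10 1025 171"
    by (simp_all add: check_strict_def upt_rec Let_def)
  then show "strict_leader 10 179" "strict_leader 10 173" "strict_leader 10 171"
    using check_strict_sound[of 10 179] check_strict_sound[of 10 173] check_strict_sound[of 10 171]
    by simp_all
  have *: "list_all (\<lambda>x. x = 179 \<or> x = 173 \<or> x = 171 \<or> check_nonleader 10 1025 x) [156..<180]"
    by (simp add: check_nonleader_def upt_rec Let_def)
  assume x: "leader 10 x" "156 \<le> x" "x \<le> 179"
  define y where "y = nat x"
  have y: "x = int y" "156 \<le> y" "y < 180" using x by (auto simp: y_def)
  have "y = 179 \<or> y = 173 \<or> y = 171 \<or> check_nonleader 10 1025 y"
  proof -
    have "y \<in> set [156..<180]" unfolding set_upt using y by simp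
    then show ?thesis using * unfolding list_all_iff by (rule bspec[rotated])
  qed
  then show "x = 179 \<or> x = 173 \<or> x = 171"
    using check_nonleader_sound[of 10 y] x(1) unfolding y(1) by auto
qed

section \<open>The defining sets of the theorem\<close>

text \<open>The body mirrors the local function \<open>ds\<close> of the theorem, so that the two
  can be identified by reflexivity after unfolding.\<close>

definition bch_delta :: "nat \<Rightarrow> nat \<Rightarrow> nat" where
  "bch_delta t i = (let d2 = 2 ^ (4 * t - 1) + (2 ^ (4 * t) - 1) div 5 in
     if i = 1 then (2 ^ (4 * t + 2) + 1) div 5 else if i = 2 then d2 else if i = 3 then d2 - 6
     else if i = 4 then (if t = 2 then d2 - 8 else d2 - 96)
     else (if t = 2 then d2 - 24 else d2 - 102))"

lemma bch_delta_1_2: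
  assumes "t \<ge> 2"
  shows "2 ^ (4 * t + 2) + 1 = 5 * bch_delta t 1"
    and "8 * bch_delta t 2 + 3 = 7 * bch_delta t 1"
    and "179 \<le> bch_delta t 2"
    and "t \<noteq> 2 \<Longrightarrow> 2000 \<le> bch_delta t 2"
proof -
  have "[16 ^ t = 1 ^ t] (mod (5::nat))" by (intro cong_pow) (simp add: cong_def)
  then have "(2::nat) ^ (4 * t) mod 5 = 1" by (simp add: power_mult cong_def)
  \<comment> \<open>With u = (2^(4t) - 1)/5 both n/5 and delta_2 become free of division.\<close>
  then obtain u where u: "(2::nat) ^ (4 * t) = 5 * u + 1"
    by (metis div_mult_mod_eq mult.commute)
  have d1: "bch_delta t 1 = 4 * u + 1" by (simp add: bch_delta_def u power_add)
  then show e1: "2 ^ (4 * t + 2) + 1 = 5 * bch_delta t 1" by (simp add: power_add u)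
  obtain h where h: "4 * t = Suc h" using assms by (cases "4 * t") auto
  have half: "2 * 2 ^ (4 * t - 1) = 5 * u + 1" unfolding u[symmetric] h by simp
  have d2: "bch_delta t 2 = 2 ^ (4 * t - 1) + u" unfolding bch_delta_def Let_def u by simp
  show e2: "8 * bch_delta t 2 + 3 = 7 * bch_delta t 1" unfolding d1 d2 using half by (simp add: algebra_simps)
  have "(2::nat) ^ 8 \<le> 2 ^ (4 * t)" using assms by (intro power_increasing) auto
  then show "179 \<le> bch_delta t 2" using half d2 unfolding u by simp
  assume "t \<noteq> 2"
  then have "(2::nat) ^ 12 \<le> 2 ^ (4 * t)" using assms by (intro power_increasing) auto
  then show "2000 \<le> bch_delta t 2" using half d2 unfolding u by simp
qed

lemma bch_delta_simps:
  "bch_delta t 3 = bch_delta t 2 - 6"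
  "bch_delta t 4 = (if t = 2 then bch_delta t 2 - 8 else bch_delta t 2 - 96)"
  "bch_delta t 5 = (if t = 2 then bch_delta t 2 - 24 else bch_delta t 2 - 102)"
  by (simp_all add: bch_delta_def)

lemma bch_delta_int:
  assumes "t \<ge> 2"
  shows "2 ^ (4 * t + 2) + 1 = 5 * int (bch_delta t 1)"
    and "8 * int (bch_delta t 2) + 3 = 7 * int (bch_delta t 1)"
proof -
  have "int (2 ^ (4 * t + 2) + 1) = int (5 * bch_delta t 1)"
    by (simp only: bch_delta_1_2(1)[OF assms])
  then show "2 ^ (4 * t + 2) + 1 = 5 * int (bch_delta t 1)" by simp
  show "8 * int (bch_delta t 2) + 3 = 7 * int (bch_delta t 1)"
    using bch_delta_1_2(2)[OF assms] by linarith
qed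

lemma bch_delta_strict_leader:
  assumes t: "t \<ge> 2" and i: "i \<in> {2, 3, 4}"
  shows "strict_leader (4 * t + 2) (int (bch_delta t i))"
proof (cases "t = 2")
  case True
  have "bch_delta 2 2 = 179" by (simp add: bch_delta_def)
  then have "bch_delta 2 3 = 173" "bch_delta 2 4 = 171" by (simp_all add: bch_delta_simps)
  then show ?thesis using i \<open>bch_delta 2 2 = 179\<close> leaders_2(1-3) True by auto
next
  case False
  then have t3: "t \<ge> 3" using t by simp
  obtain j where j: "j = 0 \<or> j = 6 \<or> j = (96::int)" "int (bch_delta t i) = int (bch_delta t 2) - j"
    using i bch_delta_1_2(4)[OF t False] False by (auto simp: bch_delta_simps of_nat_diff)
  show ?thesis
    by (rule strict_leaders_near_delta2[OF bch_delta_int(1)[OF t] t3 _ j(1)])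
       (use bch_delta_int(2)[OF t] j(2) in linarith)
qed

lemma large_leaders:
  assumes t: "t \<ge> 2" and l: "leader (4 * t + 2) (int l)" "bch_delta t 5 + 2 \<le> l"
  shows "l \<in> {bch_delta t 1, bch_delta t 2, bch_delta t 3, bch_delta t 4}"
proof (cases "7 * int (bch_delta t 1) \<le> 8 * int l")
  case True
  then show ?thesis using leader_ge_seven_eighths[OF bch_delta_int(1)[OF t] l(1)] by simp
next
  case False
  then have le: "l \<le> bch_delta t 2" using bch_delta_int(2)[OF t] by linarith
  show ?thesis
  proof (cases "t = 2")
    case True
    have "bch_delta 2 2 = 179" by (simp add: bch_delta_def)
    then have d: "bch_delta 2 3 = 173" "bch_delta 2 4 = 171" "bch_delta 2 5 = 155" "bch_delta 2 2 = 179"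
      by (simp_all add: bch_delta_simps)
    then show ?thesis using leaders_2(4)[of "int l"] l le True by auto
  next
    case False
    then have t3: "t \<ge> 3" using t by simp
    define j where "j = int (bch_delta t 2) - int l"
    have "j = 0 \<or> j = 6 \<or> j = 96"
    proof (rule leader_near_delta2[OF bch_delta_int(1)[OF t] t3 l(1)])
      show "8 * int l = 7 * int (bch_delta t 1) - 3 - 8 * j"
        using bch_delta_int(2)[OF t] by (simp add: j_def)
      show "0 \<le> j" using le by (simp add: j_def)
      \<comment> \<open>For t > 2, delta_5 + 2 = delta_2 - 100; this is the origin of the bound
        100.\<close>
      show "j \<le> 100" using l(2) bch_delta_1_2(4)[OF t False] False
        by (simp add: j_def bch_delta_simps)
    qed
    then show ?thesis using False bch_delta_1_2(4)[OF t False] le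
      unfolding j_def by (auto simp: bch_delta_simps)
  qed
qed

section \<open>The coset of n/5 and the complement of the defining set\<close>

text \<open>N divides n, so every member of its orbit is a nonzero multiple of N.\<close>

lemma leader_fifth:
  fixes N :: nat
  assumes m: "m > 0" and n: "2 ^ m + 1 = 5 * int N"
  shows "leader m (int N)"
proof -
  have N0: "0 < N"
  proof (rule ccontr)
    assume "\<not> 0 < N"
    moreover have "0 < (2::int) ^ m" by simp
    ultimately show False using n by linarith
  qed
  have "int N \<le> \<bar>y\<bar>" if y: "eqv m (int N) y" for y
  proof -
    from y obtain k where "[2 ^ k * int N = y] (mod (5 * int N))" unfolding eqv_def n by blast
    then have "5 * int N dvd 2 ^ k * int N - y" by (simp add: cong_iff_dvd_diff)
    then have "int N dvd 2 ^ k * int N - y" using dvd_mult_right by blast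
    from dvd_diff[OF dvd_triv_right[of "int N" "2 ^ k"] this] have "int N dvd y" by simp
    moreover have "y \<noteq> 0"
    proof
      assume "y = 0"
      then have "5 * int N dvd int N" using eqv_dvd[OF m y] n by simp
      then show False using zdvd_imp_le[of "5 * int N" "int N"] N0 by simp
    qed
    ultimately show ?thesis using dvd_imp_le_int[of y "int N"] by simp
  qed
  then show ?thesis using N0 by (simp add: leader_def)
qed

text \<open>N 2^k modulo 5N depends only on 2^k modulo 5, and 2 generates the units modulo
  5.\<close>

lemma card_coset_fifth:
  fixes N :: nat
  assumes "0 < N"
  shows "card (cyc_coset (5 * N) N) = 4"
proof -
  have "cyc_coset (5 * N) N = (\<lambda>r. N * r) ` {1, 2, 3, 4}"
  proof (intro equalityI subsetI)
    fix y assume "y \<in> cyc_coset (5 * N) N"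
    then obtain k where "y = N * 2 ^ k mod (N * 5)" by (auto simp: cyc_coset_def mult.commute)
    then have y: "y = N * (2 ^ k mod 5)" by simp
    have "\<not> 5 dvd (2::nat) ^ k"
    proof
      assume "5 dvd (2::nat) ^ k"
      moreover have "coprime 5 ((2::nat) ^ k)" by (rule coprime_power_right_iff[THEN iffD2]) simp
      ultimately show False by (auto dest: coprime_absorb_left)
    qed
    then have "2 ^ k mod 5 \<noteq> (0::nat)" by (simp add: mod_eq_0_iff_dvd)
    moreover have "2 ^ k mod 5 < (5::nat)" by simp
    ultimately have "2 ^ k mod 5 \<in> {1, 2, 3, 4::nat}" by auto
    then show "y \<in> (\<lambda>r. N * r) ` {1, 2, 3, 4}" unfolding y by blast
  next
    fix y assume "y \<in> (\<lambda>r. N * r) ` {1, 2, 3, 4}"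
    then obtain r where r: "r \<in> {1, 2, 3, 4::nat}" "y = N * r" by blast
    then obtain k where "2 ^ k mod 5 = r"
    proof -
      have "2 ^ 0 mod 5 = (1::nat)" "2 ^ 1 mod 5 = (2::nat)" "2 ^ 3 mod 5 = (3::nat)" "2 ^ 2 mod 5 = (4::nat)"
        by simp_all
      then show thesis using r(1) that by blast
    qed
    then have "y = N * 2 ^ k mod (5 * N)" by (simp add: r(2) mult.commute[of 5])
    then show "y \<in> cyc_coset (5 * N) N" by (auto simp: cyc_coset_def)
  qed
  then show ?thesis using assms by (simp add: card_image inj_on_def)
qed

text \<open>Each nonzero residue has exactly one leader, so it is missing from the defining set
  precisely when that leader is at least delta. \<open>G\<close> is the set of these
  leaders.\<close>

lemma cosets_below_complement:
  assumes m: "m > 0" and \<delta>: "\<delta> \<le> 2 ^ m + 1"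
    and G: "\<And>l. leader m (int l) \<Longrightarrow> \<delta> \<le> l \<longleftrightarrow> l \<in> G" "\<And>l. l \<in> G \<Longrightarrow> leader m (int l)"
  shows "cosets_below m \<delta> = {1..<2 ^ m + 1} - (\<Union>x\<in>G. cyc_coset (2 ^ m + 1) x)"
proof -
  have "j \<in> cosets_below m \<delta> \<longleftrightarrow> (\<forall>x\<in>G. j \<notin> cyc_coset (2 ^ m + 1) x)"
    if j: "j \<in> {1..<2 ^ m + 1}" for j
  proof -
    have "\<not> 2 ^ m + 1 dvd int j" using j by (intro not_dvd_small) auto
    from ex_leader[OF m this] obtain l' where l': "leader m l'" "eqv m (int j) l'" .
    define l where "l = nat l'"
    have "int l = l'" using l'(1) by (simp add: l_def leader_def)
    then have l: "leader m (int l)" "eqv m (int j) (int l)" using l' by simp_all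
    have jn: "j < 2 ^ m + 1" using j by simp
    have "j \<in> cosets_below m \<delta> \<longleftrightarrow> l \<notin> G"
      unfolding mem_cosets_below_iff[OF m l jn] G(1)[OF l(1), symmetric] by (simp add: not_le)
    also have "\<dots> \<longleftrightarrow> (\<forall>x\<in>G. j \<notin> cyc_coset (2 ^ m + 1) x)"
    proof
      assume "l \<notin> G"
      show "\<forall>x\<in>G. j \<notin> cyc_coset (2 ^ m + 1) x"
      proof (intro ballI notI)
        fix x assume x: "x \<in> G" "j \<in> cyc_coset (2 ^ m + 1) x"
        then have "eqv m (int x) (int j)" unfolding mem_cyc_coset_iff by blast
        then have "int x = int l"
          using leader_unique[OF m G(2)[OF x(1)] l(1)] eqv_trans l(2) by blast
        then show False using x \<open>l \<notin> G\<close> by simp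
      qed
    next
      assume "\<forall>x\<in>G. j \<notin> cyc_coset (2 ^ m + 1) x"
      then show "l \<notin> G" using eqv_sym[OF m l(2)] jn unfolding mem_cyc_coset_iff by blast
    qed
    finally show ?thesis .
  qed
  then show ?thesis using cosets_below_subset[OF m \<delta>] by blast
qed

lemma cosets_below_large:
  assumes t: "t \<ge> 2" and i: "i \<in> {1, 2, 3, 4}"
    and \<delta>: "bch_delta t (i + 1) + 2 \<le> \<delta>" "\<delta> \<le> bch_delta t i"
  shows "cosets_below (4 * t + 2) \<delta> = cosets_below (4 * t + 2) (bch_delta t i)"
    and "card (cosets_below (4 * t + 2) \<delta>) + (2 * (4 * t + 2) * (i - 1) + 5) = 2 ^ (4 * t + 2) + 1"
proof -
  let ?m = "4 * t + 2" and ?d = "bch_delta t"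
  have m: "?m > 0" by simp
  have d2: "179 \<le> ?d 2" "t \<noteq> 2 \<Longrightarrow> 2000 \<le> ?d 2" by (rule bch_delta_1_2[OF t])+
  have "?d 2 < ?d 1" using bch_delta_1_2(2)[OF t] d2(1) by linarith
  moreover have "?d 5 + 2 \<le> ?d 4 \<and> ?d 4 < ?d 3 \<and> ?d 3 < ?d 2"
  proof (cases "t = 2")
    case True
    then have "?d 3 = ?d 2 - 6" "?d 4 = ?d 2 - 8" "?d 5 = ?d 2 - 24" 
      by (simp_all only: bch_delta_simps refl if_True)
    then show ?thesis using d2(1) by linarith
  next
    case False
    then have "?d 3 = ?d 2 - 6" "?d 4 = ?d 2 - 96" "?d 5 = ?d 2 - 102"
      by (simp_all only: bch_delta_simps if_False)
    then show ?thesis using d2(2)[OF False] by linarith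
  qed
  ultimately have dec: "?d 5 + 2 \<le> ?d 4" "?d 4 < ?d 3" "?d 3 < ?d 2" "?d 2 < ?d 1" by linarith+
  have nx: "i = 1 \<and> ?d i = ?d 1 \<and> ?d (i + 1) = ?d 2 \<or> i = 2 \<and> ?d i = ?d 2 \<and> ?d (i + 1) = ?d 3 \<or>
    i = 3 \<and> ?d i = ?d 3 \<and> ?d (i + 1) = ?d 4 \<or> i = 4 \<and> ?d i = ?d 4 \<and> ?d (i + 1) = ?d 5"
  proof -
    have "(1::nat) + 1 = 2" "(2::nat) + 1 = 3" "(3::nat) + 1 = 4" "(4::nat) + 1 = 5" by simp_all
    then show ?thesis using i by (elim insertE emptyE) (simp_all only:, simp_all)
  qed
  obtain G where Gexp: "i = 1 \<and> G = {?d 1} \<or> i = 2 \<and> G = {?d 1, ?d 2} \<or>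
    i = 3 \<and> G = {?d 1, ?d 2, ?d 3} \<or> i = 4 \<and> G = {?d 1, ?d 2, ?d 3, ?d 4}"
    using i by (elim insertE emptyE; simp)
  have G: "leader ?m (int l)" if "l \<in> G" for l
  proof -
    have "l = ?d 1 \<or> l = ?d 2 \<or> l = ?d 3 \<or> l = ?d 4" using that Gexp by blast
    moreover have "leader ?m (int (?d k))" if "k \<in> {2, 3, 4}" for k
      by (rule strict_leader_imp_leader[OF bch_delta_strict_leader[OF t that]])
    moreover have "leader ?m (int (?d 1))" by (rule leader_fifth[OF m bch_delta_int(1)[OF t]])
    ultimately show ?thesis by blast
  qed
  have compl: "cosets_below ?m d = {1..<2 ^ ?m + 1} - (\<Union>x\<in>G. cyc_coset (2 ^ ?m + 1) x)"
    if d: "?d (i + 1) + 2 \<le> d" "d \<le> ?d i" for d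
  proof (rule cosets_below_complement[OF m])
    have "?d i \<le> ?d 1" using nx dec by linarith
    then show "d \<le> 2 ^ ?m + 1" using d bch_delta_1_2(1)[OF t] by linarith
    show "leader ?m (int l)" if "l \<in> G" for l using G that .
    fix l assume l: "leader ?m (int l)"
    show "d \<le> l \<longleftrightarrow> l \<in> G"
    proof
      assume "d \<le> l"
      have "?d 5 \<le> ?d (i + 1)" using nx dec by linarith
      then have "?d 5 + 2 \<le> l" using \<open>d \<le> l\<close> d by linarith
      then have "l \<in> {?d 1, ?d 2, ?d 3, ?d 4}" by (rule large_leaders[OF t l])
      then have "l = ?d 1 \<or> l = ?d 2 \<or> l = ?d 3 \<or> l = ?d 4" by blast
      moreover have "?d (i + 1) < l" using d \<open>d \<le> l\<close> by simp
      ultimately have "l = ?d 1 \<or> l = ?d 2 \<and> i \<ge> 2 \<or> l = ?d 3 \<and> i \<ge> 3 \<or> l = ?d 4 \<and> i = 4"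
        using nx dec by linarith
      then show "l \<in> G" using Gexp by (elim disjE conjE) simp_all
    next
      assume "l \<in> G"
      then have "l = ?d 1 \<or> l = ?d 2 \<and> i \<ge> 2 \<or> l = ?d 3 \<and> i \<ge> 3 \<or> l = ?d 4 \<and> i = 4"
        using Gexp by (elim disjE conjE) auto
      then show "d \<le> l" using nx dec d(2) by linarith
    qed
  qed
  have le: "?d (i + 1) + 2 \<le> ?d i" using \<delta> by simp
  show "cosets_below ?m \<delta> = cosets_below ?m (?d i)"
    unfolding compl[OF \<delta>] compl[OF le order_refl] ..
  have "(\<Union>x\<in>G. cyc_coset (2 ^ ?m + 1) x) \<subseteq> {1..<2 ^ ?m + 1}"
  proof
    fix j assume "j \<in> (\<Union>x\<in>G. cyc_coset (2 ^ ?m + 1) x)"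
    then obtain x where x: "x \<in> G" "j \<in> cyc_coset (2 ^ ?m + 1) x" by blast
    then have jn: "j < 2 ^ ?m + 1" and e: "eqv ?m (int x) (int j)" unfolding mem_cyc_coset_iff by blast+
    have "j \<noteq> 0"
    proof
      assume "j = 0"
      then have "int x \<le> \<bar>0\<bar>" using e G[OF x(1)] by (auto simp: leader_def)
      then show False using G[OF x(1)] by (simp add: leader_def)
    qed
    then show "j \<in> {1..<2 ^ ?m + 1}" using jn by simp
  qed
  then have "card (cosets_below ?m \<delta>) + card (\<Union>x\<in>G. cyc_coset (2 ^ ?m + 1) x) = card {1..<2 ^ ?m + 1 :: nat}"
    unfolding compl[OF \<delta>]
    by (metis card_Diff_subset card_mono finite_atLeastLessThan finite_subset le_add_diff_inverse2)
  moreover have "card (\<Union>x\<in>G. cyc_coset (2 ^ ?m + 1) x) = 4 + 2 * ?m * (i - 1)"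
  proof -
    have fin: "finite G" using Gexp by (elim disjE conjE) simp_all
    have c1: "card (cyc_coset (2 ^ ?m + 1) (?d 1)) = 4"
      unfolding bch_delta_1_2(1)[OF t] using dec by (intro card_coset_fifth) simp
    have c: "card (cyc_coset (2 ^ ?m + 1) (?d k)) = 2 * ?m" if "k \<in> {2, 3, 4}" for k
      by (rule card_strict_leader_coset[OF m bch_delta_strict_leader[OF t that]])
    have c234: "card (cyc_coset (2 ^ ?m + 1) (?d 2)) = 2 * ?m" "card (cyc_coset (2 ^ ?m + 1) (?d 3)) = 2 * ?m"
      "card (cyc_coset (2 ^ ?m + 1) (?d 4)) = 2 * ?m" by (rule c; simp)+
    have "card (\<Union>x\<in>G. cyc_coset (2 ^ ?m + 1) x) = (\<Sum>x\<in>G. card (cyc_coset (2 ^ ?m + 1) x))"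
      by (rule card_disjoint_leader_cosets[OF m fin G])
    also have "\<dots> = 4 + 2 * ?m * (i - 1)"
    proof -
      have n: "?d 1 \<notin> {?d 2}" "?d 1 \<notin> {?d 2, ?d 3}" "?d 1 \<notin> {?d 2, ?d 3, ?d 4}" "?d 2 \<notin> {?d 3}"
        "?d 2 \<notin> {?d 3, ?d 4}" "?d 3 \<notin> {?d 4}" using dec by auto
      define f where "f x = card (cyc_coset (2 ^ ?m + 1) x)" for x
      have f: "f (?d 1) = 4" "f (?d 2) = 2 * ?m" "f (?d 3) = 2 * ?m" "f (?d 4) = 2 * ?m"
        unfolding f_def using c1 c234 by simp_all
      have "sum f G = 4 + 2 * ?m * (i - 1)"
      proof -
        have s: "sum f {a} = f a" "a \<notin> {b} \<Longrightarrow> sum f {a, b} = f a + f b"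
          "a \<notin> {b, c} \<Longrightarrow> b \<notin> {c} \<Longrightarrow> sum f {a, b, c} = f a + f b + f c"
          "a \<notin> {b, c, e} \<Longrightarrow> b \<notin> {c, e} \<Longrightarrow> c \<notin> {e} \<Longrightarrow> sum f {a, b, c, e} = f a + f b + f c + f e"
          for a b c e by auto
        have "sum f {?d 1} = 4" "sum f {?d 1, ?d 2} = 4 + 2 * ?m"
          "sum f {?d 1, ?d 2, ?d 3} = 4 + 2 * ?m + 2 * ?m"
          "sum f {?d 1, ?d 2, ?d 3, ?d 4} = 4 + 2 * ?m + 2 * ?m + 2 * ?m"
          unfolding s(1) s(2)[OF n(1)] s(3)[OF n(2,4)] s(4)[OF n(3,5,6)] f by simp_all
        then show ?thesis using Gexp by (elim disjE conjE) simp_all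
      qed
      then show ?thesis unfolding f_def .
    qed
    finally show ?thesis .
  qed
  ultimately show "card (cosets_below ?m \<delta>) + (2 * ?m * (i - 1) + 5) = 2 ^ ?m + 1" by simp
qed

lemma cosets_below_all:
  assumes t: "t \<ge> 2" and \<delta>: "bch_delta t 1 < \<delta>" "\<delta> \<le> 2 ^ (4 * t + 2) + 1"
  shows "cosets_below (4 * t + 2) \<delta> = {1..<2 ^ (4 * t + 2) + 1}"
proof -
  have "cosets_below (4 * t + 2) \<delta> = {1..<2 ^ (4 * t + 2) + 1} - (\<Union>x\<in>{}. cyc_coset (2 ^ (4 * t + 2) + 1) x)"
  proof (rule cosets_below_complement)
    fix l assume "leader (4 * t + 2) (int l)"
    then have "int l \<le> int (bch_delta t 1)"
      by (rule leader_le_fifth[OF bch_delta_int(1)[OF t], rotated]) simp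
    then show "\<delta> \<le> l \<longleftrightarrow> l \<in> {}" using \<delta>(1) by simp
  qed (use \<delta> in auto)
  then show ?thesis by simp
qed

section \<open>Parameters of the codes, range by range\<close>

text \<open>A leader that is not yet reached leaves a nonzero residue outside. This keeps the
  dimension positive even after 0 is put into the defining set.\<close>

lemma card_cosets_below_less:
  assumes m: "m > 0" and l: "leader m (int l)" "\<delta> \<le> l" "l < 2 ^ m + 1"
  shows "card (cosets_below m \<delta>) < 2 ^ m"
proof -
  have "l \<notin> cosets_below m \<delta>" using mem_cosets_below_iff[OF m l(1) eqv_refl l(3)] l(2) by simp
  moreover have "l \<in> {1..<2 ^ m + 1}" using l by (auto simp: leader_def)
  moreover have "cosets_below m \<delta> \<subseteq> {1..<2 ^ m + 1}"
    using l by (intro cosets_below_subset[OF m]) simp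
  ultimately have "cosets_below m \<delta> \<subset> {1..<2 ^ m + 1}" by blast
  then have "card (cosets_below m \<delta>) < card {1..<2 ^ m + 1 :: nat}" by (intro psubset_card_mono) auto
  then show ?thesis by simp
qed

lemma (in primitive_root) bch_params:
  assumes l: "leader m (int l)" "\<delta>' \<le> l" "l < 2 ^ m + 1"
    and D: "cosets_below m \<delta> = cosets_below m \<delta>'" and \<delta>: "0 < \<delta>" "\<delta> \<le> \<delta>'"
    and card: "card (cosets_below m \<delta>) = c"
  shows "code_params (bch_code \<xi> (2 ^ m + 1) \<delta> 1) (2 ^ m + 1 - c) \<delta>'"
    and "code_params (bch_code \<xi> (2 ^ m + 1) (\<delta> + 1) 0) (2 ^ m - c) (2 * \<delta>')"
proof -
  have c: "c < 2 ^ m" using card_cosets_below_less[OF m l] card D by simp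
  have le: "\<delta>' \<le> 2 ^ m + 1" using l by simp
  show "code_params (bch_code \<xi> (2 ^ m + 1) \<delta> 1) (2 ^ m + 1 - c) \<delta>'"
    using c by (intro bch_code_params_1[OF D le]) (simp_all add: card)
  show "code_params (bch_code \<xi> (2 ^ m + 1) (\<delta> + 1) 0) (2 ^ m - c) (2 * \<delta>')"
    using c by (intro bch_code_params_0[OF D le \<delta>]) (simp_all add: card)
qed

text \<open>This is the repetition code: every nonzero residue is a zero of the generator. The BCH
  bound gives n, and no word has weight above n.\<close>

lemma (in primitive_root) bch_params_all:
  assumes t: "t \<ge> 2" and mt: "m = 4 * t + 2" and \<delta>: "bch_delta t 1 < \<delta>" "\<delta> \<le> 2 ^ m + 1"
  shows "card (bch_code \<xi> (2 ^ m + 1) \<delta> 1) = 2 ^ 1 \<and> min_dist (bch_code \<xi> (2 ^ m + 1) \<delta> 1) = 2 ^ m + 1"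
proof -
  let ?C = "bch_code \<xi> (2 ^ m + 1) \<delta> 1"
  have all: "cosets_below m \<delta> = {1..<2 ^ m + 1}" using cosets_below_all[OF t] \<delta> unfolding mt by blast
  have all': "cosets_below m (2 ^ m + 1) = {1..<2 ^ m + 1}"
    using cosets_below_all[OF t, of "2 ^ m + 1"] \<delta> unfolding mt by simp
  have p: "code_params ?C 1 (2 ^ m + 1)"
  proof (rule bch_code_params_1)
    show "cosets_below m \<delta> = cosets_below m (2 ^ m + 1)" unfolding all all' ..
    show "1 = 2 ^ m + 1 - card (cosets_below m \<delta>)" unfolding all by simp
  qed simp_all
  then have card: "card ?C = 2 ^ 1" and ge: "2 ^ m + 1 \<le> min_dist ?C" by (auto simp: code_params_def)
  have "min_dist ?C \<le> 2 ^ m + 1"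
  proof -
    have "?C - {{}} \<noteq> {}"
    proof
      assume "?C - {{}} = {}"
      then have "card ?C \<le> card {{} :: nat set}" by (intro card_mono) auto
      then show False using card by simp
    qed
    then obtain S where S: "S \<in> ?C - {{}}" by blast
    then have "S \<subseteq> {..<2 ^ m + 1}" by (auto simp: bch_code_def bin_cyclic_code_def)
    then have "card S \<le> card {..<2 ^ m + 1 :: nat}" by (intro card_mono) auto
    moreover have "min_dist ?C \<le> card S" unfolding min_dist_def using S by (intro cInf_lower) auto
    ultimately show ?thesis by simp
  qed
  then show ?thesis using card ge by simp
qed

text \<open>Makes n/5 a leader beyond the whole small range, as positivity of the dimension
  requires.\<close>

lemma fifth_ge:
  assumes t: "t \<ge> 2" and r: "r = 2 ^ (2 * t)"
  shows "6 * r + 5 \<le> bch_delta t 1"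
proof -
  have r16: "16 \<le> r" unfolding r by (rule power_2t_ge[OF t])
  have "5 * bch_delta t 1 = 4 * r\<^sup>2 + 1"
    using bch_delta_1_2(1)[OF t] unfolding r power_m_eq by simp
  moreover have "16 * r \<le> r\<^sup>2" using r16 by (simp add: power2_eq_square)
  ultimately show ?thesis using r16 by linarith
qed

lemma (in primitive_root) bch_params_small:
  assumes t: "t \<ge> 2" and mt: "m = 4 * t + 2" and r: "r = 2 ^ (2 * t)"
    and \<delta>: "odd \<delta>" "\<delta> \<le> 6 * r + 5" "\<delta> \<le> \<delta>'" "\<delta>' \<le> 6 * r + 5"
    and D: "cosets_below m \<delta> = cosets_below m \<delta>'"
    and c: "card {x \<in> small_nonleaders r. x < \<delta>} = c" "2 * c + 1 \<le> \<delta>"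
  shows "code_params (bch_code \<xi> (2 ^ m + 1) \<delta> 1) (2 ^ m + 1 + (2 * c + 1) * m - m * \<delta>) \<delta>'"
    and "code_params (bch_code \<xi> (2 ^ m + 1) (\<delta> + 1) 0) (2 ^ m + (2 * c + 1) * m - m * \<delta>) (2 * \<delta>')"
proof -
  have lead: "leader m (int (bch_delta t 1))"
    using leader_fifth[OF m] bch_delta_int(1)[OF t] unfolding mt by blast
  have le: "\<delta>' \<le> bch_delta t 1" using fifth_ge[OF t r] \<delta> by linarith
  have lt: "bch_delta t 1 < 2 ^ m + 1"
  proof -
    have "0 < bch_delta t 1" using fifth_ge[OF t r] by simp
    moreover have "2 ^ m + 1 = 5 * bch_delta t 1" using bch_delta_1_2(1)[OF t] unfolding mt .
    ultimately show ?thesis by linarith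
  qed
  from \<delta>(1) obtain d where d: "\<delta> = 2 * d + 1" by (auto elim: oddE)
  have dc: "c \<le> d" using c(2) d by simp
  have "card (cosets_below m \<delta>) = 2 * m * ((\<delta> - 1) div 2 - c)"
    using card_cosets_below_small[OF t r \<delta>(1,2)] c(1) unfolding mt by simp
  also have "\<dots> = 2 * m * (d - c)" by (simp add: d)
  finally have card: "card (cosets_below m \<delta>) = 2 * m * (d - c)" .
  obtain e where e: "d = c + e" using dc le_Suc_ex by blast
  \<comment> \<open>Both sides agree even for truncated subtraction, since (2c + 1)m is a summand of
    m delta.\<close>
  have k: "X - 2 * m * (d - c) = X + (2 * c + 1) * m - m * \<delta>" for X :: nat
    unfolding d e by (simp add: algebra_simps)
  have pos: "0 < \<delta>" using d by simp
  show "code_params (bch_code \<xi> (2 ^ m + 1) \<delta> 1) (2 ^ m + 1 + (2 * c + 1) * m - m * \<delta>) \<delta>'"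
    using bch_params(1)[OF lead le lt D pos \<delta>(3) card] unfolding k .
  show "code_params (bch_code \<xi> (2 ^ m + 1) (\<delta> + 1) 0) (2 ^ m + (2 * c + 1) * m - m * \<delta>) (2 * \<delta>')"
    using bch_params(2)[OF lead le lt D pos \<delta>(3) card] unfolding k .
qed

text \<open>Raising delta by 2 passes one of the non-leaders 6r - 1, 6r + 1, 6r + 3, so the number
  of leaders stays at 3r - 8. The sets are nested and finite of equal size, hence equal.\<close>

lemma cosets_below_plateau:
  assumes t: "t \<ge> 2" and r: "r = 2 ^ (2 * t)"
    and \<delta>: "odd \<delta>" "6 * r - 1 \<le> \<delta>" "\<delta> \<le> 6 * r + 5"
  shows "cosets_below (4 * t + 2) \<delta> = cosets_below (4 * t + 2) (6 * r + 5)"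
    and "card (cosets_below (4 * t + 2) \<delta>) = 2 * (4 * t + 2) * (3 * r - 8)"
proof -
  have r16: "16 \<le> r" unfolding r by (rule power_2t_ge[OF t])
  have card: "card (cosets_below (4 * t + 2) d) = 2 * (4 * t + 2) * (3 * r - 8)"
    if d: "odd d" "6 * r - 1 \<le> d" "d \<le> 6 * r + 5" for d
  proof -
    have "even r" unfolding r using t by simp
    then obtain s where s: "r = 2 * s" by blast
    obtain u where u: "r = 16 + u" using r16 le_Suc_ex by blast
    from d(1) obtain e where e: "d = 2 * e + 1" by (auto elim: oddE)
    have "e = 6 * s - 1 \<or> e = 6 * s \<or> e = 6 * s + 1 \<or> e = 6 * s + 2"
      using d(2,3) unfolding e s by linarith
    then have "d = 6 * r - 1 \<or> d = 6 * r + 1 \<or> d = 6 * r + 3 \<or> d = 6 * r + 5"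
      using r16 unfolding e s by linarith
    then have "(d - 1) div 2 - card {x \<in> small_nonleaders r. x < d} = 3 * r - 8"
    proof (elim disjE)
      assume d: "d = 6 * r - 1"
      have "card {x \<in> small_nonleaders r. x < d} = 7"
        by (subst card_small_nonleaders_below[OF r16]) (simp add: d u)
      then show ?thesis unfolding d s by linarith
    next
      assume d: "d = 6 * r + 1"
      have "card {x \<in> small_nonleaders r. x < d} = 8"
        by (subst card_small_nonleaders_below[OF r16]) (simp add: d u)
      then show ?thesis unfolding d s by linarith
    next
      assume d: "d = 6 * r + 3"
      have "card {x \<in> small_nonleaders r. x < d} = 9"
        by (subst card_small_nonleaders_below[OF r16]) (simp add: d u)
      then show ?thesis unfolding d s by linarith
    next
      assume d: "d = 6 * r + 5"
      have "card {x \<in> small_nonleaders r. x < d} = 10"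
        by (subst card_small_nonleaders_below[OF r16]) (simp add: d u)
      then show ?thesis unfolding d s by linarith
    qed
    then show ?thesis using card_cosets_below_small[OF t r d(1,3)] by simp
  qed
  show c: "card (cosets_below (4 * t + 2) \<delta>) = 2 * (4 * t + 2) * (3 * r - 8)" by (rule card[OF \<delta>])
  have "cosets_below (4 * t + 2) \<delta> \<subseteq> cosets_below (4 * t + 2) (6 * r + 5)"
    unfolding cosets_below_def using \<delta>(3) by (intro UN_mono) auto
  moreover have "card (cosets_below (4 * t + 2) (6 * r + 5)) = 2 * (4 * t + 2) * (3 * r - 8)"
    by (rule card) (simp_all add: r)
  ultimately show "cosets_below (4 * t + 2) \<delta> = cosets_below (4 * t + 2) (6 * r + 5)"
    using c finite_cosets_below by (intro card_subset_eq) auto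
qed

lemma (in primitive_root) bch_params_plateau:
  assumes t: "t \<ge> 2" and mt: "m = 4 * t + 2" and r: "r = 2 ^ (2 * t)"
    and \<delta>: "odd \<delta>" "6 * r - 1 \<le> \<delta>" "\<delta> \<le> 6 * r + 5"
  shows "code_params (bch_code \<xi> (2 ^ m + 1) \<delta> 1) (2 ^ m + 1 + 16 * m - m * (6 * r)) (6 * r + 5)"
    and "code_params (bch_code \<xi> (2 ^ m + 1) (\<delta> + 1) 0) (2 ^ m + 16 * m - m * (6 * r)) (2 * (6 * r + 5))"
proof -
  have r16: "16 \<le> r" unfolding r by (rule power_2t_ge[OF t])
  have lead: "leader m (int (bch_delta t 1))"
    using leader_fifth[OF m] bch_delta_int(1)[OF t] unfolding mt by blast
  have le: "6 * r + 5 \<le> bch_delta t 1" by (rule fifth_ge[OF t r])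
  have lt: "bch_delta t 1 < 2 ^ m + 1"
    using le bch_delta_1_2(1)[OF t] unfolding mt by linarith
  have D: "cosets_below m \<delta> = cosets_below m (6 * r + 5)"
    and card: "card (cosets_below m \<delta>) = 2 * m * (3 * r - 8)"
    using cosets_below_plateau[OF t r \<delta>] unfolding mt by blast+
  obtain s where s: "r = 16 + s" using r16 le_Suc_ex by blast
  have k: "X - 2 * m * (3 * r - 8) = X + 16 * m - m * (6 * r)" for X :: nat
    unfolding s by (simp add: algebra_simps)
  have pos: "0 < \<delta>" using \<delta>(1) by (rule odd_pos)
  show "code_params (bch_code \<xi> (2 ^ m + 1) \<delta> 1) (2 ^ m + 1 + 16 * m - m * (6 * r)) (6 * r + 5)"
    using bch_params(1)[OF lead le lt D pos \<delta>(3) card] unfolding k .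
  show "code_params (bch_code \<xi> (2 ^ m + 1) (\<delta> + 1) 0) (2 ^ m + 16 * m - m * (6 * r)) (2 * (6 * r + 5))"
    using bch_params(2)[OF lead le lt D pos \<delta>(3) card] unfolding k .
qed

lemma (in primitive_root) bch_params_large:
  assumes t: "t \<ge> 2" and mt: "m = 4 * t + 2" and i: "i \<in> {1, 2, 3, 4}"
    and \<delta>: "bch_delta t (i + 1) + 2 \<le> \<delta>" "\<delta> \<le> bch_delta t i"
  shows "code_params (bch_code \<xi> (2 ^ m + 1) \<delta> 1) (2 * m * (i - 1) + 5) (bch_delta t i)"
    and "code_params (bch_code \<xi> (2 ^ m + 1) (\<delta> + 1) 0) (2 * m * (i - 1) + 4) (2 * bch_delta t i)"
proof -
  let ?d = "bch_delta t"
  have lead: "leader m (int (?d 1))"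
    using leader_fifth[OF m] bch_delta_int(1)[OF t] unfolding mt by blast
  have le: "?d i \<le> ?d 1"
  proof -
    have "?d 4 \<le> ?d 2" "?d 3 \<le> ?d 2" by (simp_all add: bch_delta_simps)
    moreover have "?d 2 \<le> ?d 1" using bch_delta_1_2(2)[OF t] by linarith
    ultimately show ?thesis using i by (elim insertE emptyE) simp_all
  qed
  have n: "2 ^ m + 1 = 5 * ?d 1" using bch_delta_1_2(1)[OF t] unfolding mt .
  have lt: "?d 1 < 2 ^ m + 1" using n \<delta> le by linarith
  have D: "cosets_below m \<delta> = cosets_below m (?d i)"
    and card: "card (cosets_below m \<delta>) + (2 * m * (i - 1) + 5) = 2 ^ m + 1"
    using cosets_below_large[OF t i \<delta>] unfolding mt by blast+
  have pos: "0 < \<delta>" using \<delta>(1) by simp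
  have k: "2 ^ m + 1 - card (cosets_below m \<delta>) = 2 * m * (i - 1) + 5"
    "2 ^ m - card (cosets_below m \<delta>) = 2 * m * (i - 1) + 4" using card by linarith+
  show "code_params (bch_code \<xi> (2 ^ m + 1) \<delta> 1) (2 * m * (i - 1) + 5) (?d i)"
    using bch_params(1)[OF lead le lt D pos \<delta>(2) refl] unfolding k .
  show "code_params (bch_code \<xi> (2 ^ m + 1) (\<delta> + 1) 0) (2 * m * (i - 1) + 4) (2 * ?d i)"
    using bch_params(2)[OF lead le lt D pos \<delta>(2) refl] unfolding k .
qed

theorem theorem4p7:
  fixes \<xi> :: "'f::field" and t \<delta> :: nat
  assumes char2: "CHAR('f) = 2"
    and t: "t \<ge> 2"
    and prim: "\<xi> ^ (2 ^ (4*t+2) + 1) = 1"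
              "\<forall>k. 0 < k \<and> k < 2 ^ (4*t+2) + 1 \<longrightarrow> \<xi> ^ k \<noteq> 1"
    and odd: "odd \<delta>"
  shows
   "let m = 4*t+2; n = 2^m + 1; a = 2^(2*t+2) + 2^(2*t+1);
        d2 = 2^(4*t-1) + (2^(4*t) - 1) div 5;
        ds = (\<lambda>i::nat. if i = 1 then n div 5 else if i = 2 then d2 else if i = 3 then d2 - 6
                 else if i = 4 then (if t = 2 then d2 - 8 else d2 - 96)
                 else (if t = 2 then d2 - 24 else d2 - 102));
        C1 = bch_code \<xi> n \<delta> 1; C0 = bch_code \<xi> n (\<delta> + 1) 0
    in
    ((2^(2*t+1) + 3 \<le> \<delta> \<and> \<delta> \<le> 2^(2*t+2) - 5 \<longrightarrow> code_params C1 (n + 3*m - m*\<delta>) \<delta>) \<and>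
     (2^(2*t+2) + 5 \<le> \<delta> \<and> \<delta> \<le> 2^(2*t+2) + 2^(2*t) - 3 \<longrightarrow> code_params C1 (n + 11*m - m*\<delta>) \<delta>) \<and>
     (2^(2*t+2) + 2^(2*t) + 3 \<le> \<delta> \<and> \<delta> \<le> a - 3 \<longrightarrow> code_params C1 (n + 15*m - m*\<delta>) \<delta>) \<and>
     (a - 1 \<le> \<delta> \<and> \<delta> \<le> a + 5 \<longrightarrow> code_params C1 (n + 16*m - m*a) (a + 5)) \<and>
     (\<forall>i\<in>{1,2,3,4}. ds (i+1) + 2 \<le> \<delta> \<and> \<delta> \<le> ds i \<longrightarrow> code_params C1 (2*m*(i-1) + 5) (ds i)) \<and>
     (ds 1 + 2 \<le> \<delta> \<and> \<delta> \<le> n \<longrightarrow> card C1 = 2 ^ 1 \<and> min_dist C1 = n))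
    \<and>
    ((2^(2*t+1) + 3 \<le> \<delta> \<and> \<delta> \<le> 2^(2*t+2) - 5 \<longrightarrow> code_params C0 (2^m + 3*m - m*\<delta>) (2*\<delta>)) \<and>
     (2^(2*t+2) + 5 \<le> \<delta> \<and> \<delta> \<le> 2^(2*t+2) + 2^(2*t) - 3 \<longrightarrow> code_params C0 (2^m + 11*m - m*\<delta>) (2*\<delta>)) \<and>
     (2^(2*t+2) + 2^(2*t) + 3 \<le> \<delta> \<and> \<delta> \<le> a - 3 \<longrightarrow> code_params C0 (2^m + 15*m - m*\<delta>) (2*\<delta>)) \<and>
     (a - 1 \<le> \<delta> \<and> \<delta> \<le> a + 5 \<longrightarrow> code_params C0 (2^m + 16*m - m*a) (2*(a + 5))) \<and>
     (\<forall>i\<in>{1,2,3,4}. ds (i+1) + 2 \<le> \<delta> \<and> \<delta> \<le> ds i \<longrightarrow> code_params C0 (2*m*(i-1) + 4) (2 * ds i)))"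
proof -
  define r :: nat where "r = 2 ^ (2 * t)"
  let ?m = "4 * t + 2"
  interpret primitive_root \<xi> ?m
    by unfold_locales (use char2 prim in auto)
  have r16: "16 \<le> r" unfolding r_def by (rule power_2t_ge[OF t])
  obtain u where u: "r = 16 + u" using r16 le_Suc_ex by blast
  have pw: "(2::nat) ^ (2 * t + 1) = 2 * r" "(2::nat) ^ (2 * t + 2) = 4 * r" "(2::nat) ^ (2 * t) = r"
    by (simp_all add: r_def power_add)
  have a: "4 * r + 2 * r = 6 * r" "4 * r + r = 5 * r" by simp_all
  have ds: "(if i = 1 then (2 ^ ?m + 1) div 5
      else if i = 2 then 2 ^ (4 * t - 1) + (2 ^ (4 * t) - 1) div 5
      else if i = 3 then 2 ^ (4 * t - 1) + (2 ^ (4 * t) - 1) div 5 - 6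
      else if i = 4 then (if t = 2 then 2 ^ (4 * t - 1) + (2 ^ (4 * t) - 1) div 5 - 8
        else 2 ^ (4 * t - 1) + (2 ^ (4 * t) - 1) div 5 - 96)
      else (if t = 2 then 2 ^ (4 * t - 1) + (2 ^ (4 * t) - 1) div 5 - 24
        else 2 ^ (4 * t - 1) + (2 ^ (4 * t) - 1) div 5 - 102)) = bch_delta t i" for i :: nat
    unfolding bch_delta_def Let_def by (rule refl)
  have small: "code_params (bch_code \<xi> (2 ^ ?m + 1) \<delta> 1) (2 ^ ?m + 1 + k * ?m - ?m * \<delta>) \<delta> \<and>
      code_params (bch_code \<xi> (2 ^ ?m + 1) (\<delta> + 1) 0) (2 ^ ?m + k * ?m - ?m * \<delta>) (2 * \<delta>)"
    if c: "card {x \<in> small_nonleaders r. x < \<delta>} = c" "k = 2 * c + 1" "k \<le> \<delta>" "\<delta> \<le> 6 * r + 5" for c k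
    using bch_params_small[OF t refl r_def odd c(4) order_refl c(4) refl c(1) c(3)[unfolded c(2)]]
    unfolding c(2) by blast
  have c1: "code_params (bch_code \<xi> (2 ^ ?m + 1) \<delta> 1) (2 ^ ?m + 1 + 3 * ?m - ?m * \<delta>) \<delta> \<and>
      code_params (bch_code \<xi> (2 ^ ?m + 1) (\<delta> + 1) 0) (2 ^ ?m + 3 * ?m - ?m * \<delta>) (2 * \<delta>)"
    if "2 * r + 3 \<le> \<delta> \<and> \<delta> \<le> 4 * r - 5"
  proof -
    have "card {x \<in> small_nonleaders r. x < \<delta>} = 1"
      by (subst card_small_nonleaders_below[OF r16]) (use that in \<open>simp add: u\<close>)
    then show ?thesis by (rule small) (use that r16 in linarith)+
  qed
  have c2: "code_params (bch_code \<xi> (2 ^ ?m + 1) \<delta> 1) (2 ^ ?m + 1 + 11 * ?m - ?m * \<delta>) \<delta> \<and>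
      code_params (bch_code \<xi> (2 ^ ?m + 1) (\<delta> + 1) 0) (2 ^ ?m + 11 * ?m - ?m * \<delta>) (2 * \<delta>)"
    if "4 * r + 5 \<le> \<delta> \<and> \<delta> \<le> 5 * r - 3"
  proof -
    have "card {x \<in> small_nonleaders r. x < \<delta>} = 5"
      by (subst card_small_nonleaders_below[OF r16]) (use that in \<open>simp add: u\<close>)
    then show ?thesis by (rule small) (use that r16 in linarith)+
  qed
  have c3: "code_params (bch_code \<xi> (2 ^ ?m + 1) \<delta> 1) (2 ^ ?m + 1 + 15 * ?m - ?m * \<delta>) \<delta> \<and>
      code_params (bch_code \<xi> (2 ^ ?m + 1) (\<delta> + 1) 0) (2 ^ ?m + 15 * ?m - ?m * \<delta>) (2 * \<delta>)"
    if "5 * r + 3 \<le> \<delta> \<and> \<delta> \<le> 6 * r - 3"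
  proof -
    have "card {x \<in> small_nonleaders r. x < \<delta>} = 7"
      by (subst card_small_nonleaders_below[OF r16]) (use that in \<open>simp add: u\<close>)
    then show ?thesis by (rule small) (use that r16 in linarith)+
  qed
  note c4 = bch_params_plateau[OF t refl r_def odd]
  note c5 = bch_params_large[OF t refl]
  have c6: "card (bch_code \<xi> (2 ^ ?m + 1) \<delta> 1) = 2 ^ 1 \<and> min_dist (bch_code \<xi> (2 ^ ?m + 1) \<delta> 1) = 2 ^ ?m + 1"
    if "bch_delta t 1 + 2 \<le> \<delta> \<and> \<delta> \<le> 2 ^ ?m + 1"
    using that by (intro bch_params_all[OF t refl]) auto
  show ?thesis
    unfolding Let_def ds pw a
    by (intro conjI impI ballI; (elim conjE)?)
      (use c1 c2 c3 c6 in blast | rule c4; assumption | rule c5; assumption)+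
qed

end
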